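(* Let $A$ be a compatible associative algebra and $M$ be a compatible $A$-bimodule. Then there is a bijection between $\mathrm{Ext}(A,M)$, the set of equivalence classes of abelian extensions of $A$ by the vector space $M$ whose induced compatible $A$-bimodule structure on $M$ is the given one, and the second cohomology group $H^2_c(A,M)$.
   Context: All vector spaces are finite-dimensional over a field $\mathbb{K}$ of characteristic $0$. A compatible associative algebra is a triple $(A,\mu_1,\mu_2)$ of a vector space with two associative bilinear products, written $a\cdot_1 b$ and $a\cdot_2 b$, with $(a\cdot_1 b)\cdot_2 c+(a\cdot_2 b)\cdot_1 c=a\cdot_1(b\cdot_2 c)+a\cdot_2(b\cdot_1 c)$ for all $a,b,c$. A morphism is a linear map preserving both products. A compatible $A$-bimodule is a vector space $M$ with bilinear left and right actions $a\cdot_im$, $m\cdot_ia$ ($i=1,2$) such that for each $i$ they make $M$ a bimodule over $(A,\mu_i)$, and for all $a,b\in A$, $m\in M$: $(a\cdot_1b)\cdot_2m+(a\cdot_2b)\cdot_1m=a\cdot_1(b\cdot_2m)+a\cdot_2(b\cdot_1m)$, $(a\cdot_1m)\cdot_2b+(a\cdot_2m)\cdot_1b=a\cdot_1(m\cdot_2b)+a\cdot_2(m\cdot_1b)$, $(m\cdot_1a)\cdot_2b+(m\cdot_2a)\cdot_1b=m\cdot_1(a\cdot_2b)+m\cdot_2(a\cdot_1b)$. Cohomology: let $C^n(A,M)=\mathrm{Hom}(A^{\otimes n},M)$ and, for $i=1,2$, let $\delta_i:C^n(A,M)\to C^{n+1}(A,M)$ be the Hochschild coboundary of $(A,\mu_i)$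 with coefficients in $M$ (with the $i$-th actions): $(\delta_if)(a_1,\ldots,a_{n+1})=a_1\cdot_if(a_2,\ldots,a_{n+1})+\sum_{k=1}^n(-1)^kf(a_1,\ldots,a_k\cdot_ia_{k+1},\ldots,a_{n+1})+(-1)^{n+1}f(a_1,\ldots,a_n)\cdot_ia_{n+1}$. $H^*_c(A,M)$ is the cohomology of the complex with $C^0_c(A,M)=\{m\in M\mid a\cdot_1m-m\cdot_1a=a\cdot_2m-m\cdot_2a\ \forall a\in A\}$, $C^n_c(A,M)=C^n(A,M)^{\oplus n}$ for $n\ge1$, $\delta_c(m)(a)=a\cdot_1m-m\cdot_1a=a\cdot_2m-m\cdot_2a$ on $C^0_c$, and $\delta_c(f_1,\ldots,f_n)=(\delta_1f_1,\ldots,\delta_1f_i+\delta_2f_{i-1},\ldots,\delta_2f_n)$ for $n\ge1$ (the $i$-th entry being $\delta_1f_i+\delta_2f_{i-1}$ for $2\le i\le n$). Abelian extensions: an abelian extension of $A$ by a vector space $M$ is a short exact sequence $0\to(M,0,0)\xrightarrow{i}(B,\mu_1^B,\mu_2^B)\xrightarrow{j}(A,\mu_1,\mu_2)\to0$ of compatible associative algebras, where $M$ carries trivial (zero) products. For any linear section $s:A\to B$ of $j$, it induces a compatible $A$-bimodule structure on $M$ by $a\cdot_km=\mu_k^B(s(a),i(m))$, $m\cdot_ka=\mu_k^B(i(m),s(a))$, $k=1,2$ (identifying $M$ with $i(M)$), independent of $s$. Two abelian extensions $(B,i,j)$ and $(B',i',j')$ of $A$ by $M$ are equivalent if there is a morphism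 of compatible associative algebras $\varphi:B\to B'$ with $\varphi\circ i=i'$ and $j'\circ\varphi=j$. *)

theory Defs
  imports "Jordan_Normal_Form.Missing_VectorSpace"
begin

section \<open>Vector spaces\<close>

locale char0_field = field K for K (structure) +
  assumes char0: "n > 0 \<Longrightarrow> [(n::nat)] \<cdot> \<one> \<noteq> \<zero>"

locale fd_vectorspace = vectorspace K V + char0_field K for K and V +
  assumes finite_dimensional: fin_dim

definition bilinear_map ::
  "('k, 'c) ring_scheme \<Rightarrow> ('k, 'u, 'x) module_scheme \<Rightarrow> ('k, 'v, 'y) module_scheme \<Rightarrow>
   ('k, 'w, 'z) module_scheme \<Rightarrow> ('u \<Rightarrow> 'v \<Rightarrow> 'w) \<Rightarrow> bool" where
  "bilinear_map K U V W f \<longleftrightarrow>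
     (\<forall>u\<in>carrier U. (\<lambda>v. f u v) \<in> module_hom K V W) \<and>
     (\<forall>v\<in>carrier V. (\<lambda>u. f u v) \<in> module_hom K U W)"


section \<open>Compatible associative algebras and compatible bimodules\<close>

text \<open>The library record \<open>module\<close> extends \<open>ring\<close>; its fields \<open>mult\<close> and \<open>one\<close> play no role
  for a vector space and are left arbitrary everywhere below.\<close>

record ('k, 'a) comp_algebra = "('k, 'a) module" +
  prod1 :: "'a \<Rightarrow> 'a \<Rightarrow> 'a"  (infixl \<open>\<cdot>\<^sub>1\<index>\<close> 70)
  prod2 :: "'a \<Rightarrow> 'a \<Rightarrow> 'a"  (infixl \<open>\<cdot>\<^sub>2\<index>\<close> 70)

locale compatible_algebra = fd_vectorspace K A
  for K :: "('k, 'c) ring_scheme" and A :: "('k, 'a, 'z) comp_algebra_scheme" (structure) +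
  assumes bilinear_prod1: "bilinear_map K A A A (prod1 A)"
    and bilinear_prod2: "bilinear_map K A A A (prod2 A)"
    and assoc1: "\<lbrakk>a \<in> carrier A; b \<in> carrier A; c \<in> carrier A\<rbrakk>
      \<Longrightarrow> (a \<cdot>\<^sub>1 b) \<cdot>\<^sub>1 c = a \<cdot>\<^sub>1 (b \<cdot>\<^sub>1 c)"
    and assoc2: "\<lbrakk>a \<in> carrier A; b \<in> carrier A; c \<in> carrier A\<rbrakk>
      \<Longrightarrow> (a \<cdot>\<^sub>2 b) \<cdot>\<^sub>2 c = a \<cdot>\<^sub>2 (b \<cdot>\<^sub>2 c)"
    and compat: "\<lbrakk>a \<in> carrier A; b \<in> carrier A; c \<in> carrier A\<rbrakk>
      \<Longrightarrow> (a \<cdot>\<^sub>1 b) \<cdot>\<^sub>2 c \<oplus>\<^bsub>A\<^esub> (a \<cdot>\<^sub>2 b) \<cdot>\<^sub>1 c = a \<cdot>\<^sub>1 (b \<cdot>\<^sub>2 c) \<oplus>\<^bsub>A\<^esub> a \<cdot>\<^sub>2 (b \<cdot>\<^sub>1 c)"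

definition comp_algebra_hom ::
  "('k, 'c) ring_scheme \<Rightarrow> ('k, 'a, 'y) comp_algebra_scheme \<Rightarrow>
   ('k, 'b, 'z) comp_algebra_scheme \<Rightarrow> ('a \<Rightarrow> 'b) set" where
  "comp_algebra_hom K A B = {f \<in> module_hom K A B. \<forall>a\<in>carrier A. \<forall>b\<in>carrier A.
     f (a \<cdot>\<^sub>1\<^bsub>A\<^esub> b) = f a \<cdot>\<^sub>1\<^bsub>B\<^esub> f b \<and> f (a \<cdot>\<^sub>2\<^bsub>A\<^esub> b) = f a \<cdot>\<^sub>2\<^bsub>B\<^esub> f b}"

definition trivial_algebra :: "('k, 'm, 'z) module_scheme \<Rightarrow> ('k, 'm) comp_algebra" where
  "trivial_algebra M =
     \<lparr>carrier = carrier M, mult = mult M, one = one M, zero = zero M, add = add M,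
      smult = smult M, prod1 = (\<lambda>_ _. \<zero>\<^bsub>M\<^esub>), prod2 = (\<lambda>_ _. \<zero>\<^bsub>M\<^esub>)\<rparr>"

text \<open>\<open>a \<rhd>\<^sub>i m\<close> and \<open>m \<lhd>\<^sub>i a\<close> are the left and right actions of the algebra on the bimodule.\<close>

record ('k, 'a, 'm) comp_bimodule = "('k, 'm) module" +
  lact1 :: "'a \<Rightarrow> 'm \<Rightarrow> 'm"  (infixl \<open>\<rhd>\<^sub>1\<index>\<close> 70)
  ract1 :: "'m \<Rightarrow> 'a \<Rightarrow> 'm"  (infixl \<open>\<lhd>\<^sub>1\<index>\<close> 70)
  lact2 :: "'a \<Rightarrow> 'm \<Rightarrow> 'm"  (infixl \<open>\<rhd>\<^sub>2\<index>\<close> 70)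
  ract2 :: "'m \<Rightarrow> 'a \<Rightarrow> 'm"  (infixl \<open>\<lhd>\<^sub>2\<index>\<close> 70)

text \<open>Associative algebras are not assumed unital, so neither are bimodules.\<close>

definition bimodule_actions ::
  "('k, 'c) ring_scheme \<Rightarrow> ('k, 'a, 'y) module_scheme \<Rightarrow> ('a \<Rightarrow> 'a \<Rightarrow> 'a) \<Rightarrow>
   ('k, 'm, 'z) module_scheme \<Rightarrow> ('a \<Rightarrow> 'm \<Rightarrow> 'm) \<Rightarrow> ('m \<Rightarrow> 'a \<Rightarrow> 'm) \<Rightarrow> bool" where
  "bimodule_actions K A \<mu> M l r \<longleftrightarrow>
     bilinear_map K A M M l \<and> bilinear_map K M A M r \<and>
     (\<forall>a\<in>carrier A. \<forall>b\<in>carrier A. \<forall>m\<in>carrier M.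
        l (\<mu> a b) m = l a (l b m) \<and>
        r (l a m) b = l a (r m b) \<and>
        r (r m a) b = r m (\<mu> a b))"

locale compatible_bimodule = fd_vectorspace K M
  for K :: "('k, 'c) ring_scheme" and A :: "('k, 'a, 'y) comp_algebra_scheme"
    and M :: "('k, 'a, 'm, 'z) comp_bimodule_scheme" (structure) +
  assumes actions1: "bimodule_actions K A (prod1 A) M (lact1 M) (ract1 M)"
    and actions2: "bimodule_actions K A (prod2 A) M (lact2 M) (ract2 M)"
    and compat_ll: "\<lbrakk>a \<in> carrier A; b \<in> carrier A; m \<in> carrier M\<rbrakk>
      \<Longrightarrow> (a \<cdot>\<^sub>1\<^bsub>A\<^esub> b) \<rhd>\<^sub>2 m \<oplus>\<^bsub>M\<^esub> (a \<cdot>\<^sub>2\<^bsub>A\<^esub> b) \<rhd>\<^sub>1 m = a \<rhd>\<^sub>1 (b \<rhd>\<^sub>2 m) \<oplus>\<^bsub>M\<^esub> a \<rhd>\<^sub>2 (b \<rhd>\<^sub>1 m)"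
    and compat_lr: "\<lbrakk>a \<in> carrier A; b \<in> carrier A; m \<in> carrier M\<rbrakk>
      \<Longrightarrow> (a \<rhd>\<^sub>1 m) \<lhd>\<^sub>2 b \<oplus>\<^bsub>M\<^esub> (a \<rhd>\<^sub>2 m) \<lhd>\<^sub>1 b = a \<rhd>\<^sub>1 (m \<lhd>\<^sub>2 b) \<oplus>\<^bsub>M\<^esub> a \<rhd>\<^sub>2 (m \<lhd>\<^sub>1 b)"
    and compat_rr: "\<lbrakk>a \<in> carrier A; b \<in> carrier A; m \<in> carrier M\<rbrakk>
      \<Longrightarrow> (m \<lhd>\<^sub>1 a) \<lhd>\<^sub>2 b \<oplus>\<^bsub>M\<^esub> (m \<lhd>\<^sub>2 a) \<lhd>\<^sub>1 b = m \<lhd>\<^sub>1 (a \<cdot>\<^sub>2\<^bsub>A\<^esub> b) \<oplus>\<^bsub>M\<^esub> m \<lhd>\<^sub>2 (a \<cdot>\<^sub>1\<^bsub>A\<^esub> b)"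


section \<open>Cohomology\<close>

definition tuples :: "('a, 'z) partial_object_scheme \<Rightarrow> nat \<Rightarrow> 'a list set" where
  "tuples A n = {xs \<in> lists (carrier A). length xs = n}"

text \<open>Linear maps on the \<open>n\<close>-th tensor power are represented as \<open>n\<close>-linear maps, i.e. functions on
  lists of length \<open>n\<close> that are linear in each entry. They are \<open>undefined\<close> outside
  \<^term>\<open>tuples A n\<close>, so that equality of cochains is equality of functions.
  For \<open>n = 0\<close> a cochain amounts to its value at \<open>[]\<close>, an arbitrary element of \<open>M\<close>.\<close>

definition cochains ::
  "('k, 'c) ring_scheme \<Rightarrow> ('k, 'a, 'y) module_scheme \<Rightarrow> ('k, 'm, 'z) module_scheme \<Rightarrow>
   nat \<Rightarrow> ('a list \<Rightarrow> 'm) set" where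
  "cochains K A M n = {f \<in> tuples A n \<rightarrow>\<^sub>E carrier M.
     \<forall>xs\<in>tuples A n. \<forall>i<n. (\<lambda>a. f (xs[i := a])) \<in> module_hom K A M}"

definition cochain_add ::
  "('a, 'y) partial_object_scheme \<Rightarrow> ('m, 'z) ring_scheme \<Rightarrow> nat \<Rightarrow>
   ('a list \<Rightarrow> 'm) \<Rightarrow> ('a list \<Rightarrow> 'm) \<Rightarrow> 'a list \<Rightarrow> 'm" where
  "cochain_add A M n f g = (\<lambda>xs\<in>tuples A n. f xs \<oplus>\<^bsub>M\<^esub> g xs)"

definition zero_cochain ::
  "('a, 'y) partial_object_scheme \<Rightarrow> ('m, 'z) ring_scheme \<Rightarrow> nat \<Rightarrow> 'a list \<Rightarrow> 'm" where
  "zero_cochain A M n = (\<lambda>xs\<in>tuples A n. \<zero>\<^bsub>M\<^esub>)"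

text \<open>The Hochschild coboundary of an \<open>n\<close>-cochain; \<open>xs = [a\<^sub>1, \<dots>, a\<^sub>n\<^sub>+\<^sub>1]\<close>, so that
  \<open>a\<^sub>k\<close> is \<open>xs ! (k - 1)\<close>. For \<open>n = 0\<close> it sends \<open>m\<close> to \<open>a \<mapsto> l a m - r m a\<close>.\<close>

definition hochschild ::
  "('k, 'c) ring_scheme \<Rightarrow> ('k, 'a, 'y) module_scheme \<Rightarrow> ('a \<Rightarrow> 'a \<Rightarrow> 'a) \<Rightarrow>
   ('k, 'm, 'z) module_scheme \<Rightarrow> ('a \<Rightarrow> 'm \<Rightarrow> 'm) \<Rightarrow> ('m \<Rightarrow> 'a \<Rightarrow> 'm) \<Rightarrow>
   nat \<Rightarrow> ('a list \<Rightarrow> 'm) \<Rightarrow> 'a list \<Rightarrow> 'm" where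
  "hochschild K A \<mu> M l r n f = (\<lambda>xs\<in>tuples A (n + 1).
     l (hd xs) (f (tl xs))
     \<oplus>\<^bsub>M\<^esub> finsum M (\<lambda>k. ((\<ominus>\<^bsub>K\<^esub> \<one>\<^bsub>K\<^esub>) [^]\<^bsub>K\<^esub> k) \<odot>\<^bsub>M\<^esub>
           f (take (k - 1) xs @ [\<mu> (xs ! (k - 1)) (xs ! k)] @ drop (k + 1) xs)) {1..n}
     \<oplus>\<^bsub>M\<^esub> ((\<ominus>\<^bsub>K\<^esub> \<one>\<^bsub>K\<^esub>) [^]\<^bsub>K\<^esub> (n + 1)) \<odot>\<^bsub>M\<^esub> r (f (butlast xs)) (last xs))"

definition hochschild1 ::
  "('k, 'c) ring_scheme \<Rightarrow> ('k, 'a, 'y) comp_algebra_scheme \<Rightarrow>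
   ('k, 'a, 'm, 'z) comp_bimodule_scheme \<Rightarrow> nat \<Rightarrow> ('a list \<Rightarrow> 'm) \<Rightarrow> 'a list \<Rightarrow> 'm" where
  "hochschild1 K A M = hochschild K A (prod1 A) M (lact1 M) (ract1 M)"

definition hochschild2 ::
  "('k, 'c) ring_scheme \<Rightarrow> ('k, 'a, 'y) comp_algebra_scheme \<Rightarrow>
   ('k, 'a, 'm, 'z) comp_bimodule_scheme \<Rightarrow> nat \<Rightarrow> ('a list \<Rightarrow> 'm) \<Rightarrow> 'a list \<Rightarrow> 'm" where
  "hochschild2 K A M = hochschild K A (prod2 A) M (lact2 M) (ract2 M)"

text \<open>The \<open>n\<close>-cochains of the compatible complex are lists \<open>[f\<^sub>1, \<dots>, f\<^sub>n]\<close> of \<open>n\<close>-cochains.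
  In degree 0 they are one-element lists \<open>[f]\<close>, with \<open>f []\<close> the corresponding element of \<open>M\<close>.\<close>

definition comp_cochains ::
  "('k, 'c) ring_scheme \<Rightarrow> ('k, 'a, 'y) comp_algebra_scheme \<Rightarrow>
   ('k, 'a, 'm, 'z) comp_bimodule_scheme \<Rightarrow> nat \<Rightarrow> ('a list \<Rightarrow> 'm) list set" where
  "comp_cochains K A M n =
     (if n = 0 then
        {[f] |f. f \<in> cochains K A M 0 \<and>
           (\<forall>a\<in>carrier A. a \<rhd>\<^sub>1\<^bsub>M\<^esub> f [] \<ominus>\<^bsub>M\<^esub> f [] \<lhd>\<^sub>1\<^bsub>M\<^esub> a = a \<rhd>\<^sub>2\<^bsub>M\<^esub> f [] \<ominus>\<^bsub>M\<^esub> f [] \<lhd>\<^sub>2\<^bsub>M\<^esub> a)}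
      else {fs \<in> lists (cochains K A M n). length fs = n})"

definition comp_cochain_group ::
  "('k, 'c) ring_scheme \<Rightarrow> ('k, 'a, 'y) comp_algebra_scheme \<Rightarrow>
   ('k, 'a, 'm, 'z) comp_bimodule_scheme \<Rightarrow> nat \<Rightarrow> ('a list \<Rightarrow> 'm) list monoid" where
  "comp_cochain_group K A M n =
     \<lparr>carrier = comp_cochains K A M n,
      mult = map2 (cochain_add A M n),
      one = replicate (if n = 0 then 1 else n) (zero_cochain A M n)\<rparr>"

definition comp_coboundary ::
  "('k, 'c) ring_scheme \<Rightarrow> ('k, 'a, 'y) comp_algebra_scheme \<Rightarrow>
   ('k, 'a, 'm, 'z) comp_bimodule_scheme \<Rightarrow> nat \<Rightarrow>
   ('a list \<Rightarrow> 'm) list \<Rightarrow> ('a list \<Rightarrow> 'm) list" where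
  "comp_coboundary K A M n fs =
     (if n = 0 then [hochschild1 K A M 0 (hd fs)]
      else [hochschild1 K A M n (hd fs)]
        @ map (\<lambda>i. cochain_add A M (n + 1)
                 (hochschild1 K A M n (fs ! i)) (hochschild2 K A M n (fs ! (i - 1)))) [1..<n]
        @ [hochschild2 K A M n (last fs)])"

definition comp_cocycles ::
  "('k, 'c) ring_scheme \<Rightarrow> ('k, 'a, 'y) comp_algebra_scheme \<Rightarrow>
   ('k, 'a, 'm, 'z) comp_bimodule_scheme \<Rightarrow> nat \<Rightarrow> ('a list \<Rightarrow> 'm) list set" where
  "comp_cocycles K A M n =
     kernel (comp_cochain_group K A M n) (comp_cochain_group K A M (n + 1))
       (comp_coboundary K A M n)"

definition comp_coboundaries ::
  "('k, 'c) ring_scheme \<Rightarrow> ('k, 'a, 'y) comp_algebra_scheme \<Rightarrow>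
   ('k, 'a, 'm, 'z) comp_bimodule_scheme \<Rightarrow> nat \<Rightarrow> ('a list \<Rightarrow> 'm) list set" where
  "comp_coboundaries K A M n =
     (if n = 0 then {\<one>\<^bsub>comp_cochain_group K A M 0\<^esub>}
      else comp_coboundary K A M (n - 1) ` comp_cochains K A M (n - 1))"

definition comp_cohomology ::
  "('k, 'c) ring_scheme \<Rightarrow> ('k, 'a, 'y) comp_algebra_scheme \<Rightarrow>
   ('k, 'a, 'm, 'z) comp_bimodule_scheme \<Rightarrow> nat \<Rightarrow> ('a list \<Rightarrow> 'm) list set monoid" where
  "comp_cohomology K A M n =
     (comp_cochain_group K A M n)\<lparr>carrier := comp_cocycles K A M n\<rparr> Mod comp_coboundaries K A M n"


section \<open>Abelian extensions\<close>

record ('k, 'a, 'm, 'b) extension =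
  total :: "('k, 'b) comp_algebra"
  incl :: "'m \<Rightarrow> 'b"
  proj :: "'b \<Rightarrow> 'a"

definition abelian_extension ::
  "('k, 'c) ring_scheme \<Rightarrow> ('k, 'a, 'y) comp_algebra_scheme \<Rightarrow> ('k, 'm, 'z) module_scheme \<Rightarrow>
   ('k, 'a, 'm, 'b) extension \<Rightarrow> bool" where
  "abelian_extension K A M E \<longleftrightarrow>
     compatible_algebra K (total E) \<and>
     incl E \<in> comp_algebra_hom K (trivial_algebra M) (total E) \<and>
     proj E \<in> comp_algebra_hom K (total E) A \<and>
     inj_on (incl E) (carrier M) \<and>
     incl E ` carrier M = {b \<in> carrier (total E). proj E b = \<zero>\<^bsub>A\<^esub>} \<and>
     proj E ` carrier (total E) = carrier A"

definition linear_section ::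
  "('k, 'c) ring_scheme \<Rightarrow> ('k, 'a, 'y) comp_algebra_scheme \<Rightarrow>
   ('k, 'a, 'm, 'b) extension \<Rightarrow> ('a \<Rightarrow> 'b) \<Rightarrow> bool" where
  "linear_section K A E s \<longleftrightarrow>
     s \<in> module_hom K A (total E) \<and> (\<forall>a\<in>carrier A. proj E (s a) = a)"

text \<open>The bimodule structure on \<open>M\<close> induced by the extension (through any linear section) is
  the given one. Linear sections always exist, so the quantification over them is not vacuous.\<close>

definition induces_bimodule ::
  "('k, 'c) ring_scheme \<Rightarrow> ('k, 'a, 'y) comp_algebra_scheme \<Rightarrow>
   ('k, 'a, 'm, 'z) comp_bimodule_scheme \<Rightarrow> ('k, 'a, 'm, 'b) extension \<Rightarrow> bool" where
  "induces_bimodule K A M E \<longleftrightarrow>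
     (\<forall>s. linear_section K A E s \<longrightarrow>
       (\<forall>a\<in>carrier A. \<forall>m\<in>carrier M.
          incl E (a \<rhd>\<^sub>1\<^bsub>M\<^esub> m) = s a \<cdot>\<^sub>1\<^bsub>total E\<^esub> incl E m \<and>
          incl E (m \<lhd>\<^sub>1\<^bsub>M\<^esub> a) = incl E m \<cdot>\<^sub>1\<^bsub>total E\<^esub> s a \<and>
          incl E (a \<rhd>\<^sub>2\<^bsub>M\<^esub> m) = s a \<cdot>\<^sub>2\<^bsub>total E\<^esub> incl E m \<and>
          incl E (m \<lhd>\<^sub>2\<^bsub>M\<^esub> a) = incl E m \<cdot>\<^sub>2\<^bsub>total E\<^esub> s a))"

definition equivalent_extensions ::
  "('k, 'c) ring_scheme \<Rightarrow> ('k, 'm, 'z) module_scheme \<Rightarrow>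
   ('k, 'a, 'm, 'b) extension \<Rightarrow> ('k, 'a, 'm, 'b) extension \<Rightarrow> bool" where
  "equivalent_extensions K M E E' \<longleftrightarrow>
     (\<exists>\<phi>\<in>comp_algebra_hom K (total E) (total E').
        (\<forall>m\<in>carrier M. \<phi> (incl E m) = incl E' m) \<and>
        (\<forall>b\<in>carrier (total E). proj E' (\<phi> b) = proj E b))"

text \<open>The type \<open>'b\<close> is the universe from which the elements of the middle terms are drawn. It
  must be able to hold a copy of the set \<open>A \<times> M\<close> for every extension to be equivalent to one over it;
  \<open>'a \<times> 'm\<close> always qualifies.\<close>

definition extensions_inducing ::
  "('k, 'c) ring_scheme \<Rightarrow> ('k, 'a, 'y) comp_algebra_scheme \<Rightarrow>
   ('k, 'a, 'm, 'z) comp_bimodule_scheme \<Rightarrow> ('k, 'a, 'm, 'b) extension set" where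
  "extensions_inducing K A M = {E. abelian_extension K A M E \<and> induces_bimodule K A M E}"

definition Ext ::
  "('k, 'c) ring_scheme \<Rightarrow> ('k, 'a, 'y) comp_algebra_scheme \<Rightarrow>
   ('k, 'a, 'm, 'z) comp_bimodule_scheme \<Rightarrow> ('k, 'a, 'm, 'b) extension set set" where
  "Ext K A M = extensions_inducing K A M //
     {(E, E'). E \<in> extensions_inducing K A M \<and> E' \<in> extensions_inducing K A M \<and>
               equivalent_extensions K M E E'}"

end

theory Submission
  imports Defs
begin

text \<open>The argument is Schreier's description of extensions by factor sets. Let \<open>E\<close> be an abelian
  extension with inclusion \<open>\<iota>\<close> of \<open>M\<close> and projection \<open>\<pi>\<close> onto \<open>A\<close>. Because \<open>A\<close> is finite-dimensional,
  \<open>\<pi>\<close> has a linear section \<open>s\<close>, and every element of the middle term is uniquely \<open>s a + \<iota> m\<close>. As \<open>s\<close>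
  need not be multiplicative, its defect \<open>f\<^sub>i\<close> in
  \<open>s a \<cdot>\<^sub>i s b = s (a \<cdot>\<^sub>i b) + \<iota> (f\<^sub>i a b)\<close>, for \<open>i = 1, 2\<close>, defines a pair of bilinear maps,
  the factor set of \<open>s\<close>. The action of \<open>A\<close> on \<open>M\<close> being prescribed, the factor set determines both
  products on the middle term (\<open>product_section_add_incl\<close>).

  Three computations turn this into cohomology. Comparing the two ways of bracketing
  \<open>s a\<close>, \<open>s b\<close>, \<open>s c\<close> shows that a factor set is a 2-cocycle (\<open>factor_set_cocycle\<close>). Any other section
  is \<open>s + \<iota> g\<close> for a linear map \<open>g\<close> from \<open>A\<close> to \<open>M\<close>, and its factor set is the old one plus the
  coboundary of \<open>g\<close> (\<open>factor_set_iff_add_coboundary\<close>). Conversely a 2-cocycle twists the products of the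
  direct sum of \<open>A\<close> and \<open>M\<close> into an extension having it as a factor set (\<open>factor_set_twisted\<close>).

  So the set of all factor sets of \<open>E\<close> is a full coset of the coboundaries inside the
  cocycles, that is, an element of the second cohomology group, and each element arises. An
  equivalence of extensions carries sections to sections with the same factor set, and two
  extensions with a common factor set are equivalent through
  \<open>s a + \<iota> m \<mapsto> s' a + \<iota>' m\<close>. Hence equivalence means having the same set of factor sets
  (\<open>equivalent_iff_factor_sets_eq\<close>), and the bijection sends the class of \<open>E\<close> to the set of factor
  sets of \<open>E\<close>.

  The two associative laws and the compatibility law are instances of a single polarised law
  in two indices, the associative laws being recovered from its diagonal instances by dividing by 2.
  The same holds for the bimodule axioms and for the three components of the cocycle condition,
  so each computation above is made once, for indices \<open>i\<close> and \<open>j\<close>.\<close>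

section \<open>Linear algebra\<close>

lemma (in mod_hom) span_preimage:
  assumes "X \<subseteq> carrier M" and "S \<subseteq> carrier N" and "f ` X \<subseteq> N.span S"
  shows "f ` M.span X \<subseteq> N.span S"
proof -
  interpret S: submodule R "N.span S" N
    by (rule N.span_is_submodule) fact
  \<comment> \<open>A preimage of a submodule is a submodule, so it contains the span of any set that it contains.\<close>
  have "submodule R {m \<in> carrier M. f m \<in> N.span S} M"
    by (unfold_locales) auto
  from M.span_is_subset[OF _ this, of X] show ?thesis
    using assms by auto
qed

text \<open>Finite dimension of the middle term of an extension comes from the outer terms: the images of
  generating sets under \<open>f\<close> and \<open>g\<close> together generate \<open>V\<close>.\<close>

lemma (in vectorspace) fin_dim_if_sum_of_images:
  assumes "vectorspace K U" "vectorspace.fin_dim K U" "f \<in> module_hom K U V"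
    and "vectorspace K W" "vectorspace.fin_dim K W" "g \<in> module_hom K W V"
    and sum: "\<And>v. v \<in> carrier V \<Longrightarrow> \<exists>u\<in>carrier U. \<exists>w\<in>carrier W. v = f u \<oplus>\<^bsub>V\<^esub> g w"
  shows fin_dim
proof -
  interpret U: vectorspace K U by fact
  interpret W: vectorspace K W by fact
  interpret f: mod_hom K U V f using assms(3) by unfold_locales
  interpret g: mod_hom K W V g using assms(6) by unfold_locales
  obtain X where X: "finite X" "X \<subseteq> carrier U" "U.gen_set X"
    using assms(2) unfolding U.fin_dim_def by blast
  obtain Y where Y: "finite Y" "Y \<subseteq> carrier W" "W.gen_set Y"
    using assms(5) unfolding W.fin_dim_def by blast
  let ?S = "f ` X \<union> g ` Y"
  have S: "?S \<subseteq> carrier V" using X(2) Y(2) by auto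
  have "f ` X \<subseteq> span ?S" "g ` Y \<subseteq> span ?S" using in_own_span[OF S] by auto
  hence "f ` carrier U \<subseteq> span ?S" "g ` carrier W \<subseteq> span ?S"
    using f.span_preimage[OF X(2) S] g.span_preimage[OF Y(2) S] X(3) Y(3) by auto
  hence "v \<in> span ?S" if "v \<in> carrier V" for v
    using sum[OF that] span_add1[OF S] by blast
  hence "gen_set ?S" using span_is_subset2[OF S] by blast
  moreover have "finite ?S" using X(1) Y(1) by simp
  ultimately show ?thesis unfolding fin_dim_def using S by blast
qed

text \<open>The right inverse sends each vector of a finite basis \<open>X\<close> of \<open>W\<close> to some preimage and is extended
  linearly. Applied to the projection of an extension, it is a linear section.\<close>

lemma linear_right_inverse_exists:
  fixes V :: "('k, 'v, 'x) module_scheme" and W :: "('k, 'w, 'y) module_scheme"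
  assumes "vectorspace K V" and "vectorspace K W" and fd: "vectorspace.fin_dim K W"
    and T: "T \<in> module_hom K V W" and surj: "T ` carrier V = carrier W"
  obtains s where "s \<in> module_hom K W V" "\<And>w. w \<in> carrier W \<Longrightarrow> T (s w) = w"
proof -
  interpret V: vectorspace K V by fact
  interpret W: vectorspace K W by fact
  interpret T: mod_hom K V W T using T by unfold_locales
  obtain X where X: "finite X" "W.basis X" using W.finite_basis_exists[OF fd] by blast
  have XW: "X \<subseteq> carrier W" using X(2) unfolding W.basis_def by blast
  have ex1: "\<exists>!a. a \<in> X \<rightarrow>\<^sub>E carrier K \<and> W.lincomb a X = w" if "w \<in> carrier W" for w
    using W.basis_criterion[OF X(1) XW] X(2) that by blast
  \<comment> \<open>The coordinates of \<open>w\<close>; their uniqueness is what makes \<open>s\<close> below linear.\<close>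
  define c where "c w = (THE a. a \<in> X \<rightarrow>\<^sub>E carrier K \<and> W.lincomb a X = w)" for w
  have c: "c w \<in> X \<rightarrow>\<^sub>E carrier K" "W.lincomb (c w) X = w" if "w \<in> carrier W" for w
    using theI'[OF ex1[OF that]] unfolding c_def by auto
  have c_mem: "c w x \<in> carrier K" if "w \<in> carrier W" "x \<in> X" for w x
    using c(1)[OF that(1)] that(2) by auto
  have c_eq: "c w x = a x" if "w \<in> carrier W" "x \<in> X" "a \<in> X \<rightarrow> carrier K" "W.lincomb a X = w" for w x a
  proof -
    have "W.lincomb (restrict a X) X = w"
      using that XW by (subst W.lincomb_cong[of X X _ a]) auto
    moreover have "restrict a X \<in> X \<rightarrow>\<^sub>E carrier K" using that by auto
    ultimately have "c w = restrict a X" using ex1[OF that(1)] c[OF that(1)] by blast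
    thus ?thesis using that(2) by simp
  qed
  have "\<forall>x\<in>X. \<exists>v\<in>carrier V. T v = x" using surj XW by (metis imageE subsetD)
  then obtain t where t: "\<And>x. x \<in> X \<Longrightarrow> t x \<in> carrier V" "\<And>x. x \<in> X \<Longrightarrow> T (t x) = x"
    by metis
  define s where "s w = (\<Oplus>\<^bsub>V\<^esub>x\<in>X. c w x \<odot>\<^bsub>V\<^esub> t x)" for w
  have s_mem: "s w \<in> carrier V" if "w \<in> carrier W" for w
    unfolding s_def using c_mem[OF that] t(1) by (intro V.finsum_closed) auto
  have s_add: "s (v \<oplus>\<^bsub>W\<^esub> w) = s v \<oplus>\<^bsub>V\<^esub> s w" if v: "v \<in> carrier W" and w: "w \<in> carrier W" for v w
  proof -
    have mem: "(\<lambda>x. c v x \<oplus>\<^bsub>K\<^esub> c w x) \<in> X \<rightarrow> carrier K" using c_mem v w by auto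
    have "W.lincomb (\<lambda>x. c v x \<oplus>\<^bsub>K\<^esub> c w x) X = W.lincomb (c v) X \<oplus>\<^bsub>W\<^esub> W.lincomb (c w) X"
      using W.lincomb_sum[OF X(1) XW, of "c v" "c w"] c_mem v w by auto
    hence "W.lincomb (\<lambda>x. c v x \<oplus>\<^bsub>K\<^esub> c w x) X = v \<oplus>\<^bsub>W\<^esub> w" using c(2) v w by simp
    note e = c_eq[OF _ _ mem this]
    have "s (v \<oplus>\<^bsub>W\<^esub> w) = (\<Oplus>\<^bsub>V\<^esub>x\<in>X. c v x \<odot>\<^bsub>V\<^esub> t x \<oplus>\<^bsub>V\<^esub> c w x \<odot>\<^bsub>V\<^esub> t x)"
      unfolding s_def using c_mem t(1) v w e
      by (intro V.finsum_cong') (auto simp: V.smult_l_distr)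
    also have "\<dots> = s v \<oplus>\<^bsub>V\<^esub> s w"
      unfolding s_def using c_mem t(1) v w by (intro V.finsum_addf) auto
    finally show ?thesis .
  qed
  have s_smult: "s (k \<odot>\<^bsub>W\<^esub> w) = k \<odot>\<^bsub>V\<^esub> s w" if k: "k \<in> carrier K" and w: "w \<in> carrier W" for k w
  proof -
    have mem: "(\<lambda>x. k \<otimes>\<^bsub>K\<^esub> c w x) \<in> X \<rightarrow> carrier K" using c_mem k w by auto
    have "W.lincomb (\<lambda>x. k \<otimes>\<^bsub>K\<^esub> c w x) X = k \<odot>\<^bsub>W\<^esub> w"
      using W.lincomb_smult[OF XW, of "c w" k] c_mem k w c(2) by auto
    note e = c_eq[OF _ _ mem this]
    have "s (k \<odot>\<^bsub>W\<^esub> w) = (\<Oplus>\<^bsub>V\<^esub>x\<in>X. k \<odot>\<^bsub>V\<^esub> (c w x \<odot>\<^bsub>V\<^esub> t x))"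
      unfolding s_def using c_mem t(1) k w e
      by (intro V.finsum_cong') (auto simp: V.smult_assoc1)
    also have "\<dots> = k \<odot>\<^bsub>V\<^esub> s w"
      unfolding s_def using c_mem t(1) k w by (intro V.finsum_smult[symmetric]) auto
    finally show ?thesis .
  qed
  have "s \<in> module_hom K W V"
    unfolding module_hom_def using s_mem s_add s_smult by auto
  moreover have "T (s w) = w" if w: "w \<in> carrier W" for w
  proof -
    have "T (\<Oplus>\<^bsub>V\<^esub>x\<in>Y. g x) = (\<Oplus>\<^bsub>W\<^esub>x\<in>Y. T (g x))"
      if "finite Y" "g \<in> Y \<rightarrow> carrier V" for Y and g :: "'w \<Rightarrow> 'v"
      using that
    proof (induction Y rule: finite_induct)
      case (insert x F)
      thus ?case by (simp add: Pi_iff)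
    qed simp
    hence "T (s w) = (\<Oplus>\<^bsub>W\<^esub>x\<in>X. T (c w x \<odot>\<^bsub>V\<^esub> t x))"
      unfolding s_def using X(1) c_mem[OF w] t(1) by auto
    also have "\<dots> = (\<Oplus>\<^bsub>W\<^esub>x\<in>X. c w x \<odot>\<^bsub>W\<^esub> x)"
      using c_mem w t XW by (intro W.finsum_cong') auto
    also have "\<dots> = w" using c(2)[OF w] unfolding W.lincomb_def .
    finally show ?thesis .
  qed
  ultimately show ?thesis using that by blast
qed

text \<open>Division by 2, which is where characteristic 0 enters.\<close>

lemma (in fd_vectorspace) double_cancel:
  assumes x: "x \<in> carrier V" and y: "y \<in> carrier V" and eq: "x \<oplus>\<^bsub>V\<^esub> x = y \<oplus>\<^bsub>V\<^esub> y"
  shows "x = y"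
proof -
  \<comment> \<open>The scalar 2 is invertible.\<close>
  define t where "t = \<one>\<^bsub>K\<^esub> \<oplus>\<^bsub>K\<^esub> \<one>\<^bsub>K\<^esub>"
  have t: "t \<in> carrier K" "t \<noteq> \<zero>\<^bsub>K\<^esub>"
    using char0[of 2] unfolding t_def by (auto simp: numeral_2_eq_2)
  have "t \<odot>\<^bsub>V\<^esub> x = t \<odot>\<^bsub>V\<^esub> y"
    unfolding t_def using x y eq by (simp add: smult_l_distr)
  hence "(inv\<^bsub>K\<^esub> t \<otimes>\<^bsub>K\<^esub> t) \<odot>\<^bsub>V\<^esub> x = (inv\<^bsub>K\<^esub> t \<otimes>\<^bsub>K\<^esub> t) \<odot>\<^bsub>V\<^esub> y"
    using t x y by (simp add: smult_assoc1)
  moreover have "inv\<^bsub>K\<^esub> t \<otimes>\<^bsub>K\<^esub> t = \<one>\<^bsub>K\<^esub>" using t field_Units by (simp add: Units_l_inv)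
  ultimately show ?thesis using x y by simp
qed

locale bilinear = U: module K U + V: module K V + W: module K W
  for K :: "('k, 'c) ring_scheme" and U :: "('k, 'u, 'x) module_scheme"
    and V :: "('k, 'v, 'y) module_scheme" and W :: "('k, 'w, 'z) module_scheme" +
  fixes f
  assumes bilin: "bilinear_map K U V W f"
begin

lemma hom_left: "v \<in> carrier V \<Longrightarrow> (\<lambda>u. f u v) \<in> module_hom K U W"
  and hom_right: "u \<in> carrier U \<Longrightarrow> f u \<in> module_hom K V W"
  using bilin unfolding bilinear_map_def by auto

lemma closed [simp, intro]: "u \<in> carrier U \<Longrightarrow> v \<in> carrier V \<Longrightarrow> f u v \<in> carrier W"
  using hom_right unfolding module_hom_def by blast

lemma add_left [simp]:
  "\<lbrakk>u \<in> carrier U; u' \<in> carrier U; v \<in> carrier V\<rbrakk> \<Longrightarrow> f (u \<oplus>\<^bsub>U\<^esub> u') v = f u v \<oplus>\<^bsub>W\<^esub> f u' v"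
  using hom_left unfolding module_hom_def by blast

lemma add_right [simp]:
  "\<lbrakk>u \<in> carrier U; v \<in> carrier V; v' \<in> carrier V\<rbrakk> \<Longrightarrow> f u (v \<oplus>\<^bsub>V\<^esub> v') = f u v \<oplus>\<^bsub>W\<^esub> f u v'"
  using hom_right unfolding module_hom_def by blast

lemma smult_left [simp]:
  "\<lbrakk>k \<in> carrier K; u \<in> carrier U; v \<in> carrier V\<rbrakk> \<Longrightarrow> f (k \<odot>\<^bsub>U\<^esub> u) v = k \<odot>\<^bsub>W\<^esub> f u v"
  using hom_left unfolding module_hom_def by blast

lemma smult_right [simp]:
  "\<lbrakk>k \<in> carrier K; u \<in> carrier U; v \<in> carrier V\<rbrakk> \<Longrightarrow> f u (k \<odot>\<^bsub>V\<^esub> v) = k \<odot>\<^bsub>W\<^esub> f u v"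
  using hom_right unfolding module_hom_def by blast

lemma zero_left [simp]: "v \<in> carrier V \<Longrightarrow> f \<zero>\<^bsub>U\<^esub> v = \<zero>\<^bsub>W\<^esub>"
  using smult_left[of "\<zero>\<^bsub>K\<^esub>" "\<zero>\<^bsub>U\<^esub>" v] by simp

lemma zero_right [simp]: "u \<in> carrier U \<Longrightarrow> f u \<zero>\<^bsub>V\<^esub> = \<zero>\<^bsub>W\<^esub>"
  using smult_right[of "\<zero>\<^bsub>K\<^esub>" u "\<zero>\<^bsub>V\<^esub>"] by simp

end

section \<open>Polarised axioms\<close>

text \<open>Indexing products, actions and cochain components by a two-element type makes it possible to
  state and prove the facts about both structures, and about their interaction, simultaneously.\<close>

datatype label = L1 | L2

primrec product :: "('k, 'a, 'z) comp_algebra_scheme \<Rightarrow> label \<Rightarrow> 'a \<Rightarrow> 'a \<Rightarrow> 'a" where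
  "product A L1 = prod1 A"
| "product A L2 = prod2 A"

primrec lact :: "('k, 'a, 'm, 'z) comp_bimodule_scheme \<Rightarrow> label \<Rightarrow> 'a \<Rightarrow> 'm \<Rightarrow> 'm" where
  "lact M L1 = lact1 M"
| "lact M L2 = lact2 M"

primrec ract :: "('k, 'a, 'm, 'z) comp_bimodule_scheme \<Rightarrow> label \<Rightarrow> 'm \<Rightarrow> 'a \<Rightarrow> 'm" where
  "ract M L1 = ract1 M"
| "ract M L2 = ract2 M"

primrec component :: "'f list \<Rightarrow> label \<Rightarrow> 'f" where
  "component fs L1 = fs ! 0"
| "component fs L2 = fs ! 1"

lemma all_label: "(\<forall>i. P i) \<longleftrightarrow> P L1 \<and> P L2"
  by (metis label.exhaust)

context compatible_algebra
begin

lemma bilinear_product: "bilinear_map K A A A (product A i)"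
  using bilinear_prod1 bilinear_prod2 by (cases i) auto

sublocale product: bilinear K A A A "product A i" for i
  by unfold_locales (rule bilinear_product)

lemma prod_closed:
  assumes "a \<in> carrier A" "b \<in> carrier A"
  shows "prod1 A a b \<in> carrier A" "prod2 A a b \<in> carrier A"
  using product.closed[OF assms, of L1] product.closed[OF assms, of L2] by simp_all

lemma product_assoc:
  "\<lbrakk>a \<in> carrier A; b \<in> carrier A; c \<in> carrier A\<rbrakk> \<Longrightarrow>
    product A i (product A i a b) c = product A i a (product A i b c)"
  using assoc1 assoc2 by (cases i) auto

text \<open>For \<open>i \<noteq> j\<close> this is the compatibility law; for \<open>i = j\<close> it is twice the associative law.\<close>

lemma polarised_assoc:
  assumes [simp]: "a \<in> carrier A" "b \<in> carrier A" "c \<in> carrier A"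
  shows "product A i (product A j a b) c \<oplus>\<^bsub>A\<^esub> product A j (product A i a b) c =
    product A i a (product A j b c) \<oplus>\<^bsub>A\<^esub> product A j a (product A i b c)"
proof (cases "i = j")
  case True
  thus ?thesis by (simp add: product_assoc)
next
  case False
  thus ?thesis using compat[of a b c]
    by (cases i; cases j) (simp_all add: a_comm prod_closed)
qed

end

text \<open>The converse of the preceding observation: the diagonal instances of the polarised law
  give associativity after division by 2.\<close>

lemma compatible_algebraI_polarised:
  fixes A :: "('k, 'a, 'z) comp_algebra_scheme" (structure)
  assumes "fd_vectorspace K A" and bil: "\<And>i. bilinear_map K A A A (product A i)"
    and pol: "\<And>i j a b c. \<lbrakk>a \<in> carrier A; b \<in> carrier A; c \<in> carrier A\<rbrakk> \<Longrightarrow>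
      product A i (product A j a b) c \<oplus> product A j (product A i a b) c =
      product A i a (product A j b c) \<oplus> product A j a (product A i b c)"
  shows "compatible_algebra K A"
proof -
  interpret fd_vectorspace K A by fact
  interpret p: bilinear K A A A "product A i" for i by unfold_locales (rule bil)
  have assoc: "product A i (product A i a b) c = product A i a (product A i b c)"
    if "a \<in> carrier A" "b \<in> carrier A" "c \<in> carrier A" for i a b c
    using that by (intro double_cancel[OF _ _ pol[OF that, of i i]]) simp_all
  show ?thesis
  proof
    show "bilinear_map K A A A (prod1 A)" "bilinear_map K A A A (prod2 A)"
      using bil[of L1] bil[of L2] by simp_all
  next
    fix a b c assume abc: "a \<in> carrier A" "b \<in> carrier A" "c \<in> carrier A"
    show "(a \<cdot>\<^sub>1 b) \<cdot>\<^sub>1 c = a \<cdot>\<^sub>1 (b \<cdot>\<^sub>1 c)" "(a \<cdot>\<^sub>2 b) \<cdot>\<^sub>2 c = a \<cdot>\<^sub>2 (b \<cdot>\<^sub>2 c)"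
      using assoc[OF abc, of L1] assoc[OF abc, of L2] by simp_all
    have "(a \<cdot>\<^sub>1 b) \<cdot>\<^sub>2 c \<oplus> (a \<cdot>\<^sub>2 b) \<cdot>\<^sub>1 c = a \<cdot>\<^sub>2 (b \<cdot>\<^sub>1 c) \<oplus> a \<cdot>\<^sub>1 (b \<cdot>\<^sub>2 c)"
      using pol[OF abc, of L2 L1] by simp
    also have "\<dots> = a \<cdot>\<^sub>1 (b \<cdot>\<^sub>2 c) \<oplus> a \<cdot>\<^sub>2 (b \<cdot>\<^sub>1 c)"
      using p.closed[OF abc(1) p.closed[OF abc(2,3), of L1], of L2]
        p.closed[OF abc(1) p.closed[OF abc(2,3), of L2], of L1]
      by (intro a_comm) (simp_all add: abc)
    finally show "(a \<cdot>\<^sub>1 b) \<cdot>\<^sub>2 c \<oplus> (a \<cdot>\<^sub>2 b) \<cdot>\<^sub>1 c = a \<cdot>\<^sub>1 (b \<cdot>\<^sub>2 c) \<oplus> a \<cdot>\<^sub>2 (b \<cdot>\<^sub>1 c)" .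
  qed
qed

locale algebra_with_bimodule = A: compatible_algebra K A + M: compatible_bimodule K A M
  for K :: "('k, 'c) ring_scheme" and A :: "('k, 'a, 'y) comp_algebra_scheme"
    and M :: "('k, 'a, 'm, 'z) comp_bimodule_scheme"
begin

lemma actions: "bimodule_actions K A (product A i) M (lact M i) (ract M i)"
  using M.actions1 M.actions2 by (cases i) auto

sublocale lact: bilinear K A M M "lact M i" for i
  using actions[of i] unfolding bimodule_actions_def by unfold_locales auto

sublocale ract: bilinear K M A M "ract M i" for i
  using actions[of i] unfolding bimodule_actions_def by unfold_locales auto

lemma act_closed:
  assumes "a \<in> carrier A" "m \<in> carrier M"
  shows "lact1 M a m \<in> carrier M" "lact2 M a m \<in> carrier M"
    "ract1 M m a \<in> carrier M" "ract2 M m a \<in> carrier M"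
  using lact.closed[OF assms, of L1] lact.closed[OF assms, of L2]
    ract.closed[OF assms(2,1), of L1] ract.closed[OF assms(2,1), of L2] by simp_all

text \<open>The three compatibility laws of a bimodule in polarised form, the diagonal instances being
  twice the ordinary bimodule laws.\<close>

lemma lact_lact:
  assumes [simp]: "a \<in> carrier A" "b \<in> carrier A" "m \<in> carrier M"
  shows "lact M i (product A j a b) m \<oplus>\<^bsub>M\<^esub> lact M j (product A i a b) m =
    lact M i a (lact M j b m) \<oplus>\<^bsub>M\<^esub> lact M j a (lact M i b m)"
proof (cases "i = j")
  case True
  thus ?thesis using actions[of j] unfolding bimodule_actions_def by simp
next
  case False
  thus ?thesis
    using M.compat_ll[of a b m]
    by (cases i; cases j) (simp_all add: M.a_comm act_closed A.prod_closed)
qed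

lemma lact_ract:
  assumes [simp]: "a \<in> carrier A" "b \<in> carrier A" "m \<in> carrier M"
  shows "ract M i (lact M j a m) b \<oplus>\<^bsub>M\<^esub> ract M j (lact M i a m) b =
    lact M i a (ract M j m b) \<oplus>\<^bsub>M\<^esub> lact M j a (ract M i m b)"
proof (cases "i = j")
  case True
  thus ?thesis using actions[of j] unfolding bimodule_actions_def by simp
next
  case False
  thus ?thesis
    using M.compat_lr[of a b m]
    by (cases i; cases j) (simp_all add: M.a_comm act_closed A.prod_closed)
qed

lemma ract_ract:
  assumes [simp]: "a \<in> carrier A" "b \<in> carrier A" "m \<in> carrier M"
  shows "ract M i (ract M j m a) b \<oplus>\<^bsub>M\<^esub> ract M j (ract M i m a) b =
    ract M i m (product A j a b) \<oplus>\<^bsub>M\<^esub> ract M j m (product A i a b)"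
proof (cases "i = j")
  case True
  thus ?thesis using actions[of j] unfolding bimodule_actions_def by simp
next
  case False
  thus ?thesis
    using M.compat_rr[of a b m]
    by (cases i; cases j) (simp_all add: M.a_comm act_closed A.prod_closed)
qed

end

section \<open>Cochains of low degree\<close>

lemma tuples_1: "xs \<in> tuples A 1 \<longleftrightarrow> (\<exists>a\<in>carrier A. xs = [a])"
  unfolding tuples_def by (auto simp: length_Suc_conv)

lemma tuples_2: "xs \<in> tuples A 2 \<longleftrightarrow> (\<exists>a\<in>carrier A. \<exists>b\<in>carrier A. xs = [a, b])"
  unfolding tuples_def by (auto simp: length_Suc_conv numeral_2_eq_2)

lemma tuples_3: "xs \<in> tuples A 3 \<longleftrightarrow>
    (\<exists>a\<in>carrier A. \<exists>b\<in>carrier A. \<exists>c\<in>carrier A. xs = [a, b, c])"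
  unfolding tuples_def by (auto simp: length_Suc_conv numeral_3_eq_3)

lemma cochains_1_iff:
  "f \<in> cochains K A M 1 \<longleftrightarrow>
     f \<in> extensional (tuples A 1) \<and> (\<lambda>a. f [a]) \<in> module_hom K A M"
  unfolding cochains_def PiE_def Pi_def Ball_def tuples_1
  by (auto simp: module_hom_def)

lemma cochains_2_iff:
  "f \<in> cochains K A M 2 \<longleftrightarrow>
     f \<in> extensional (tuples A 2) \<and> bilinear_map K A A M (\<lambda>a b. f [a, b])"
proof
  assume f: "f \<in> cochains K A M 2"
  have "(\<lambda>x. f ([a, b][i := x])) \<in> module_hom K A M"
    if "a \<in> carrier A" "b \<in> carrier A" "i < 2" for a b i
  proof -
    have "[a, b] \<in> tuples A 2" using that by (simp add: tuples_2)
    thus ?thesis using f that(3) unfolding cochains_def by blast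
  qed
  from this[of _ _ 0] this[of _ _ 1]
  have "bilinear_map K A A M (\<lambda>a b. f [a, b])"
    unfolding bilinear_map_def by auto
  thus "f \<in> extensional (tuples A 2) \<and> bilinear_map K A A M (\<lambda>a b. f [a, b])"
    using f unfolding cochains_def by (auto simp: PiE_def)
next
  assume f: "f \<in> extensional (tuples A 2) \<and> bilinear_map K A A M (\<lambda>a b. f [a, b])"
  have "f [a, b] \<in> carrier M" if "a \<in> carrier A" "b \<in> carrier A" for a b
    using f that unfolding bilinear_map_def module_hom_def by blast
  moreover have "(\<lambda>x. f ([a, b][i := x])) \<in> module_hom K A M"
    if "a \<in> carrier A" "b \<in> carrier A" "i < 2" for a b i
    using f that unfolding bilinear_map_def by (auto simp: less_2_cases_iff)
  ultimately show "f \<in> cochains K A M 2"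
    using f unfolding cochains_def by (auto simp: tuples_2 PiE_def)
qed

lemma ball_tuples_3: "(\<forall>xs\<in>tuples A 3. P xs) \<longleftrightarrow>
    (\<forall>a\<in>carrier A. \<forall>b\<in>carrier A. \<forall>c\<in>carrier A. P [a, b, c])"
  unfolding Ball_def tuples_3 by blast

lemma comp_cochains_1: "comp_cochains K A M 1 = {[g] |g. g \<in> cochains K A M 1}"
  unfolding comp_cochains_def by (auto simp: length_Suc_conv)

lemma comp_cochains_2_iff:
  "fs \<in> comp_cochains K A M 2 \<longleftrightarrow> length fs = 2 \<and> (\<forall>i. component fs i \<in> cochains K A M 2)"
  unfolding comp_cochains_def all_label by (auto simp: length_Suc_conv numeral_2_eq_2)

lemma comp_cochains_2_eqI:
  assumes fs: "fs \<in> comp_cochains K A M 2" and gs: "gs \<in> comp_cochains K A M 2"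
    and eq: "\<And>i a b. \<lbrakk>a \<in> carrier A; b \<in> carrier A\<rbrakk> \<Longrightarrow> component fs i [a, b] = component gs i [a, b]"
  shows "fs = gs"
proof -
  have "component fs i = component gs i" for i
    using fs gs eq unfolding comp_cochains_2_iff cochains_2_iff
    by (intro extensionalityI[of _ "tuples A 2"]) (auto simp: tuples_2)
  from this[of L1] this[of L2] show ?thesis
    using fs gs unfolding comp_cochains_2_iff
    by (intro nth_equalityI) (auto simp: less_2_cases_iff)
qed

lemma module_hom_comp:
  "\<lbrakk>f \<in> module_hom K U V; g \<in> module_hom K V W\<rbrakk> \<Longrightarrow> (\<lambda>x. g (f x)) \<in> module_hom K U W"
  unfolding module_hom_def Pi_def by auto

lemma (in module) module_hom_add_pointwise:
  "\<lbrakk>f \<in> module_hom R U M; g \<in> module_hom R U M\<rbrakk> \<Longrightarrow> (\<lambda>x. f x \<oplus>\<^bsub>M\<^esub> g x) \<in> module_hom R U M"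
  unfolding module_hom_def Pi_def by (auto simp: M.a_ac smult_r_distr)

lemma (in module) module_hom_uminus_pointwise:
  "f \<in> module_hom R U M \<Longrightarrow> (\<lambda>x. \<ominus>\<^bsub>M\<^esub> f x) \<in> module_hom R U M"
  unfolding module_hom_def Pi_def by (auto simp: M.minus_add smult_r_minus)

text \<open>The left-hand side has the shape of a sum of two Hochschild coboundaries of 2-cochains. Moving the
  negative terms across gives the form in which it appears when two bracketings are compared.\<close>

lemma (in abelian_group) sum_of_alternating_sums_eq_zero_iff:
  assumes [simp]: "x \<in> carrier G" "y \<in> carrier G" "z \<in> carrier G" "w \<in> carrier G"
    "x' \<in> carrier G" "y' \<in> carrier G" "z' \<in> carrier G" "w' \<in> carrier G"
  shows "(x \<oplus> (\<ominus> y \<oplus> z) \<oplus> \<ominus> w) \<oplus> (x' \<oplus> (\<ominus> y' \<oplus> z') \<oplus> \<ominus> w') = \<zero> \<longleftrightarrow>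
    (w \<oplus> y') \<oplus> (w' \<oplus> y) = (x \<oplus> z') \<oplus> (x' \<oplus> z)"
proof -
  have "(x \<oplus> (\<ominus> y \<oplus> z) \<oplus> \<ominus> w) \<oplus> (x' \<oplus> (\<ominus> y' \<oplus> z') \<oplus> \<ominus> w') =
      ((x \<oplus> z') \<oplus> (x' \<oplus> z)) \<ominus> ((w \<oplus> y') \<oplus> (w' \<oplus> y))"
    by (simp add: a_minus_def minus_add a_ac)
  thus ?thesis by (metis add.m_closed assms minus_other_side)
qed

context algebra_with_bimodule
begin

abbreviation \<delta> :: "label \<Rightarrow> nat \<Rightarrow> ('a list \<Rightarrow> 'm) \<Rightarrow> 'a list \<Rightarrow> 'm" where
  "\<delta> i n f \<equiv> hochschild K A (product A i) M (lact M i) (ract M i) n f"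

lemma cochain_1_hom: "g \<in> cochains K A M 1 \<Longrightarrow> (\<lambda>a. g [a]) \<in> module_hom K A M"
  unfolding cochains_1_iff by blast

lemma cochain_1_closed: "\<lbrakk>g \<in> cochains K A M 1; a \<in> carrier A\<rbrakk> \<Longrightarrow> g [a] \<in> carrier M"
  using cochain_1_hom unfolding module_hom_def by blast

lemma bilinear_cochain:
  assumes "fs \<in> comp_cochains K A M 2"
  shows "bilinear K A A M (\<lambda>a b. component fs i [a, b])"
  using assms unfolding comp_cochains_2_iff cochains_2_iff by unfold_locales auto

lemmas cochain_2_closed = bilinear.closed[OF bilinear_cochain]

lemma comp_cochains_2_exists:
  assumes "\<And>i. bilinear K A A M (F i)"
  shows "\<exists>fs\<in>comp_cochains K A M 2. \<forall>i. \<forall>a\<in>carrier A. \<forall>b\<in>carrier A. component fs i [a, b] = F i a b"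
proof -
  interpret F: bilinear K A A M "F i" for i by fact
  define fs where "fs = map (\<lambda>i. \<lambda>xs\<in>tuples A 2. F i (xs ! 0) (xs ! 1)) [L1, L2]"
  have comp: "component fs i = (\<lambda>xs\<in>tuples A 2. F i (xs ! 0) (xs ! 1))" for i
    unfolding fs_def by (cases i) auto
  have val: "component fs i [a, b] = F i a b" if "a \<in> carrier A" "b \<in> carrier A" for i a b
    using that unfolding comp by (auto simp: tuples_2)
  have "bilinear_map K A A M (\<lambda>a b. component fs i [a, b])" for i
    unfolding bilinear_map_def module_hom_def Pi_def by (auto simp: val)
  moreover have "component fs i \<in> extensional (tuples A 2)" for i
    unfolding comp by simp
  ultimately have "fs \<in> comp_cochains K A M 2"
    unfolding comp_cochains_2_iff cochains_2_iff by (simp add: fs_def)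
  thus ?thesis using val by blast
qed

lemma hochschild_degree_1:
  assumes g: "g \<in> cochains K A M 1" and ab [simp]: "a \<in> carrier A" "b \<in> carrier A"
  shows "\<delta> i 1 g [a, b] =
    lact M i a (g [b]) \<oplus>\<^bsub>M\<^esub> \<ominus>\<^bsub>M\<^esub> g [product A i a b] \<oplus>\<^bsub>M\<^esub> ract M i (g [a]) b"
proof -
  note [simp] = cochain_1_closed[OF g]
  have "[a, b] \<in> tuples A (1 + 1)" by (simp add: tuples_def)
  thus ?thesis
    unfolding hochschild_def
    by (simp add: M.smult_minus_1 A.R.nat_pow_Suc numeral_2_eq_2 A.R.r_minus A.R.l_minus)
qed

lemma hochschild_degree_2:
  assumes f: "bilinear K A A M (\<lambda>a b. f [a, b])"
    and abc [simp]: "a \<in> carrier A" "b \<in> carrier A" "c \<in> carrier A"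
  shows "\<delta> i 2 f [a, b, c] =
    lact M i a (f [b, c]) \<oplus>\<^bsub>M\<^esub> (\<ominus>\<^bsub>M\<^esub> f [product A i a b, c] \<oplus>\<^bsub>M\<^esub> f [a, product A i b c])
      \<oplus>\<^bsub>M\<^esub> \<ominus>\<^bsub>M\<^esub> ract M i (f [a, b]) c"
proof -
  note [simp] = bilinear.closed[OF f]
  have "[a, b, c] \<in> tuples A (2 + 1)" by (simp add: tuples_def)
  moreover have "{1..2::nat} = {1, 2}" by auto
  ultimately show ?thesis
    unfolding hochschild_def
    by (simp add: M.smult_minus_1 A.R.nat_pow_Suc numeral_2_eq_2 numeral_3_eq_3 A.R.r_minus A.R.l_minus)
qed

text \<open>The identity for \<open>i\<close> and \<open>j\<close> says \<open>\<delta>\<^sub>i f\<^sub>j + \<delta>\<^sub>j f\<^sub>i = 0\<close>. Off the diagonal this is the middle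
  component of the cocycle condition, on the diagonal it is twice one of the outer components. Each
  side adds the \<open>M\<close>-coordinates of one bracketing of \<open>s a\<close>, \<open>s b\<close>, \<open>s c\<close> over both orders of \<open>i\<close> and \<open>j\<close>.\<close>

lemma comp_cocycles_2_iff:
  "fs \<in> comp_cocycles K A M 2 \<longleftrightarrow> fs \<in> comp_cochains K A M 2 \<and>
    (\<forall>a\<in>carrier A. \<forall>b\<in>carrier A. \<forall>c\<in>carrier A. \<forall>i j.
       (ract M i (component fs j [a, b]) c \<oplus>\<^bsub>M\<^esub> component fs i [product A j a b, c]) \<oplus>\<^bsub>M\<^esub>
       (ract M j (component fs i [a, b]) c \<oplus>\<^bsub>M\<^esub> component fs j [product A i a b, c]) =
       (lact M i a (component fs j [b, c]) \<oplus>\<^bsub>M\<^esub> component fs i [a, product A j b c]) \<oplus>\<^bsub>M\<^esub>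
       (lact M j a (component fs i [b, c]) \<oplus>\<^bsub>M\<^esub> component fs j [a, product A i b c]))"
  (is "_ \<longleftrightarrow> _ \<and> (\<forall>a\<in>_. \<forall>b\<in>_. \<forall>c\<in>_. \<forall>i j. ?P i j a b c)")
proof (cases "fs \<in> comp_cochains K A M 2")
  case True
  let ?f = "component fs"
  interpret f: bilinear K A A M "\<lambda>a b. ?f i [a, b]" for i
    by (rule bilinear_cochain) fact
  have D: "\<delta> i 2 (?f j) [a, b, c] \<in> carrier M"
    if "a \<in> carrier A" "b \<in> carrier A" "c \<in> carrier A" for i j a b c
    using that by (simp add: hochschild_degree_2[OF f.bilinear_axioms] f.closed)
  have P: "\<delta> i 2 (?f j) [a, b, c] \<oplus>\<^bsub>M\<^esub> \<delta> j 2 (?f i) [a, b, c] = \<zero>\<^bsub>M\<^esub> \<longleftrightarrow> ?P i j a b c"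
    if "a \<in> carrier A" "b \<in> carrier A" "c \<in> carrier A" for i j a b c
    unfolding hochschild_degree_2[OF f.bilinear_axioms that]
    using that f.closed by (intro M.sum_of_alternating_sums_eq_zero_iff) auto
  have double: "x \<oplus>\<^bsub>M\<^esub> x = \<zero>\<^bsub>M\<^esub> \<longleftrightarrow> x = \<zero>\<^bsub>M\<^esub>" if "x \<in> carrier M" for x
    using M.double_cancel[OF that M.M.zero_closed] by auto
  obtain f g where fs: "fs = [f, g]"
    using True unfolding comp_cochains_2_iff by (auto simp: length_Suc_conv numeral_2_eq_2)
  have "fs \<in> comp_cocycles K A M 2 \<longleftrightarrow> comp_coboundary K A M 2 fs = replicate 3 (zero_cochain A M 3)"
    using True unfolding comp_cocycles_def kernel_def comp_cochain_group_def by (simp)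
  also have "\<dots> \<longleftrightarrow>
      \<delta> L1 2 f = zero_cochain A M 3 \<and>
      cochain_add A M 3 (\<delta> L1 2 g) (\<delta> L2 2 f) = zero_cochain A M 3 \<and>
      \<delta> L2 2 g = zero_cochain A M 3"
    unfolding comp_coboundary_def hochschild1_def hochschild2_def fs
    by (simp add: numeral_3_eq_3 numeral_2_eq_2)
  also have "\<dots> \<longleftrightarrow> (\<forall>xs\<in>tuples A 3.
      \<delta> L1 2 f xs = \<zero>\<^bsub>M\<^esub> \<and> \<delta> L1 2 g xs \<oplus>\<^bsub>M\<^esub> \<delta> L2 2 f xs = \<zero>\<^bsub>M\<^esub> \<and> \<delta> L2 2 g xs = \<zero>\<^bsub>M\<^esub>)"
  proof -
    have ext: "h = zero_cochain A M 3 \<longleftrightarrow> (\<forall>xs\<in>tuples A 3. h xs = \<zero>\<^bsub>M\<^esub>)"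
      if "h \<in> extensional (tuples A 3)" for h
      using that unfolding zero_cochain_def by (auto intro: extensionalityI)
    have e: "\<delta> i 2 h = zero_cochain A M 3 \<longleftrightarrow> (\<forall>xs\<in>tuples A 3. \<delta> i 2 h xs = \<zero>\<^bsub>M\<^esub>)" for i h
      by (rule ext) (simp add: hochschild_def)
    have e': "cochain_add A M 3 h h' = zero_cochain A M 3 \<longleftrightarrow>
        (\<forall>xs\<in>tuples A 3. h xs \<oplus>\<^bsub>M\<^esub> h' xs = \<zero>\<^bsub>M\<^esub>)" for h h'
      by (subst ext) (auto simp: cochain_add_def)
    show ?thesis unfolding e e' by blast
  qed
  also have "\<dots> \<longleftrightarrow> (\<forall>a\<in>carrier A. \<forall>b\<in>carrier A. \<forall>c\<in>carrier A. \<forall>i j.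
      \<delta> i 2 (?f j) [a, b, c] \<oplus>\<^bsub>M\<^esub> \<delta> j 2 (?f i) [a, b, c] = \<zero>\<^bsub>M\<^esub>)" (is "?L \<longleftrightarrow> ?R")
  proof -
    have "(\<forall>i j. \<delta> i 2 (?f j) [a, b, c] \<oplus>\<^bsub>M\<^esub> \<delta> j 2 (?f i) [a, b, c] = \<zero>\<^bsub>M\<^esub>) \<longleftrightarrow>
        \<delta> L1 2 f [a, b, c] = \<zero>\<^bsub>M\<^esub> \<and>
        \<delta> L1 2 g [a, b, c] \<oplus>\<^bsub>M\<^esub> \<delta> L2 2 f [a, b, c] = \<zero>\<^bsub>M\<^esub> \<and>
        \<delta> L2 2 g [a, b, c] = \<zero>\<^bsub>M\<^esub>" (is "?l \<longleftrightarrow> ?r")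
      if abc: "a \<in> carrier A" "b \<in> carrier A" "c \<in> carrier A" for a b c
    proof -
      have f: "?f L1 = f" "?f L2 = g" by (simp_all add: fs)
      have "\<delta> L2 2 f [a, b, c] \<oplus>\<^bsub>M\<^esub> \<delta> L1 2 g [a, b, c] = \<delta> L1 2 g [a, b, c] \<oplus>\<^bsub>M\<^esub> \<delta> L2 2 f [a, b, c]"
        using D[OF abc, of L2 L1] D[OF abc, of L1 L2] unfolding f by (rule M.a_comm)
      thus ?thesis
        unfolding all_label f
        using double[OF D[OF abc, of L1 L1]] double[OF D[OF abc, of L2 L2]] unfolding f by metis
    qed
    thus ?thesis unfolding ball_tuples_3 by (intro ball_cong refl) simp
  qed
  also have "\<dots> \<longleftrightarrow> (\<forall>a\<in>carrier A. \<forall>b\<in>carrier A. \<forall>c\<in>carrier A. \<forall>i j. ?P i j a b c)"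
    by (intro ball_cong refl iff_allI P)
  finally show ?thesis using True by blast
qed (simp add: comp_cocycles_def kernel_def comp_cochain_group_def)

definition add_coboundary :: "('a list \<Rightarrow> 'm) \<Rightarrow> ('a list \<Rightarrow> 'm) list \<Rightarrow> ('a list \<Rightarrow> 'm) list" where
  "add_coboundary g fs = map2 (cochain_add A M 2) (comp_coboundary K A M 1 [g]) fs"

lemma coset_eq_add_coboundary:
  "comp_coboundaries K A M 2 #>\<^bsub>(comp_cochain_group K A M 2)\<lparr>carrier := comp_cocycles K A M 2\<rparr>\<^esub> fs =
     {add_coboundary g fs |g. g \<in> cochains K A M 1}"
proof -
  have "comp_coboundaries K A M 2 = (\<lambda>g. comp_coboundary K A M 1 [g]) ` cochains K A M 1"
    unfolding comp_coboundaries_def using comp_cochains_1[of K A M] by auto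
  thus ?thesis
    unfolding r_coset_def add_coboundary_def comp_cochain_group_def by auto
qed

lemma component_add_coboundary:
  assumes "g \<in> cochains K A M 1" "fs \<in> comp_cochains K A M 2" "a \<in> carrier A" "b \<in> carrier A"
  shows "component (add_coboundary g fs) i [a, b] =
    (lact M i a (g [b]) \<oplus>\<^bsub>M\<^esub> \<ominus>\<^bsub>M\<^esub> g [product A i a b] \<oplus>\<^bsub>M\<^esub> ract M i (g [a]) b) \<oplus>\<^bsub>M\<^esub> component fs i [a, b]"
proof -
  obtain f f' where fs: "fs = [f, f']"
    using assms(2) unfolding comp_cochains_2_iff by (auto simp: length_Suc_conv numeral_2_eq_2)
  have "component (add_coboundary g fs) i = cochain_add A M 2 (\<delta> i 1 g) (component fs i)"
    unfolding add_coboundary_def fs comp_coboundary_def hochschild1_def hochschild2_def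
    by (cases i) auto
  thus ?thesis
    using assms(3,4) unfolding hochschild_degree_1[OF assms(1,3,4), symmetric] cochain_add_def
    by (simp add: tuples_2)
qed

text \<open>The values of \<open>add_coboundary g fs\<close> are visibly bilinear; extensionality then identifies it with the
  cochain having these values.\<close>

lemma add_coboundary_closed:
  assumes g: "g \<in> cochains K A M 1" and fs: "fs \<in> comp_cochains K A M 2"
  shows "add_coboundary g fs \<in> comp_cochains K A M 2"
proof -
  interpret f: bilinear K A A M "\<lambda>a b. component fs i [a, b]" for i
    by (rule bilinear_cochain) fact
  let ?F = "\<lambda>i a b. (lact M i a (g [b]) \<oplus>\<^bsub>M\<^esub> \<ominus>\<^bsub>M\<^esub> g [product A i a b] \<oplus>\<^bsub>M\<^esub> ract M i (g [a]) b)
    \<oplus>\<^bsub>M\<^esub> component fs i [a, b]"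
  note hom = cochain_1_hom[OF g]
  have "bilinear_map K A A M (?F i)" for i
    unfolding bilinear_map_def
    by (intro conjI ballI M.module_hom_add_pointwise M.module_hom_uminus_pointwise
        f.hom_left f.hom_right module_hom_comp[OF _ hom] A.product.hom_left A.product.hom_right
        module_hom_comp[OF hom] lact.hom_left lact.hom_right ract.hom_left ract.hom_right
        cochain_1_closed[OF g])
  hence bil: "bilinear K A A M (?F i)" for i by unfold_locales
  obtain gs where gs: "gs \<in> comp_cochains K A M 2"
      "\<And>i a b. \<lbrakk>a \<in> carrier A; b \<in> carrier A\<rbrakk> \<Longrightarrow> component gs i [a, b] = ?F i a b"
    using comp_cochains_2_exists[of ?F, OF bil] by blast
  have len: "length (add_coboundary g fs) = 2"
    using fs unfolding add_coboundary_def comp_coboundary_def comp_cochains_2_iff by simp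
  have "component (add_coboundary g fs) i \<in> extensional (tuples A 2)" for i
    using len unfolding add_coboundary_def by (cases i) (auto simp: cochain_add_def case_prod_beta)
  moreover have "component (add_coboundary g fs) i [a, b] = component gs i [a, b]"
    if "a \<in> carrier A" "b \<in> carrier A" for i a b
    using component_add_coboundary[OF g fs that] gs(2)[OF that] by simp
  ultimately have "component (add_coboundary g fs) i = component gs i" for i
    using gs(1) unfolding comp_cochains_2_iff cochains_2_iff
    by (intro extensionalityI[of _ "tuples A 2"]) (auto simp: tuples_2)
  thus ?thesis using gs(1) len unfolding comp_cochains_2_iff by simp
qed

end

section \<open>Sections and factor sets\<close>

definition factor_set ::
  "('k, 'c) ring_scheme \<Rightarrow> ('k, 'a, 'y) comp_algebra_scheme \<Rightarrow> ('k, 'a, 'm, 'z) comp_bimodule_scheme \<Rightarrow>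
   ('k, 'a, 'm, 'b) extension \<Rightarrow> ('a \<Rightarrow> 'b) \<Rightarrow> ('a list \<Rightarrow> 'm) list \<Rightarrow> bool" where
  "factor_set K A M E s fs \<longleftrightarrow>
     linear_section K A E s \<and> fs \<in> comp_cochains K A M 2 \<and>
     (\<forall>i. \<forall>a\<in>carrier A. \<forall>b\<in>carrier A.
        product (total E) i (s a) (s b) =
          s (product A i a b) \<oplus>\<^bsub>total E\<^esub> incl E (component fs i [a, b]))"

lemma factor_setD:
  assumes "factor_set K A M E s fs"
  shows "linear_section K A E s" and "fs \<in> comp_cochains K A M 2"
    and "\<lbrakk>a \<in> carrier A; b \<in> carrier A\<rbrakk> \<Longrightarrow> product (total E) i (s a) (s b) =
      s (product A i a b) \<oplus>\<^bsub>total E\<^esub> incl E (component fs i [a, b])"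
proof -
  note f = assms[unfolded factor_set_def]
  show "linear_section K A E s" by (rule f[THEN conjunct1])
  show "fs \<in> comp_cochains K A M 2" by (rule f[THEN conjunct2, THEN conjunct1])
  show "product (total E) i (s a) (s b) =
      s (product A i a b) \<oplus>\<^bsub>total E\<^esub> incl E (component fs i [a, b])"
    if "a \<in> carrier A" "b \<in> carrier A"
    by (rule f[THEN conjunct2, THEN conjunct2, rule_format, OF that])
qed

lemma (in abelian_group) add_minus_cancel:
  assumes "x \<in> carrier G" "y \<in> carrier G"
  shows "(x \<oplus> y) \<ominus> x = y" and "x \<oplus> (y \<ominus> x) = y"
proof -
  have "(x \<oplus> y) \<ominus> x = (y \<oplus> x) \<oplus> \<ominus> x"
    using a_comm[OF assms] by (simp only: a_minus_def)
  also have "\<dots> = y" using assms by (simp add: a_assoc r_neg)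
  finally show "(x \<oplus> y) \<ominus> x = y" .
  have "x \<oplus> (y \<ominus> x) = (y \<ominus> x) \<oplus> x" using assms by (intro a_comm minus_closed)
  also have "\<dots> = y" using assms by (simp add: a_minus_def a_assoc l_neg)
  finally show "x \<oplus> (y \<ominus> x) = y" .
qed

text \<open>A linear map with values in the image of an injective linear map \<open>f\<close> factors linearly through \<open>f\<close>.\<close>

lemma (in module) module_hom_inv_into:
  assumes f: "f \<in> module_hom R N M" and inj: "inj_on f (carrier N)" and N: "module R N"
    and h: "h \<in> module_hom R U M" and range: "h ` carrier U \<subseteq> f ` carrier N"
  shows "(\<lambda>u. inv_into (carrier N) f (h u)) \<in> module_hom R U N"
proof -
  interpret N: module R N by fact
  let ?g = "inv_into (carrier N) f"
  have g: "?g (h u) \<in> carrier N" "f (?g (h u)) = h u" if "u \<in> carrier U" for u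
  proof -
    have "h u \<in> f ` carrier N" using range that by blast
    thus "?g (h u) \<in> carrier N" "f (?g (h u)) = h u" by (rule inv_into_into, rule f_inv_into_f)
  qed
  have eq: "?g y = x" if "x \<in> carrier N" "y = f x" for x y
    using that inj by (simp add: inv_into_f_f)
  show ?thesis
    using f h unfolding module_hom_def Pi_def by (auto simp: g intro!: eq)
qed

locale inducing_extension = algebra_with_bimodule K A M
  for K :: "('k, 'c) ring_scheme" and A :: "('k, 'a, 'y) comp_algebra_scheme"
    and M :: "('k, 'a, 'm, 'z) comp_bimodule_scheme"
    and E :: "('k, 'a, 'm, 'b) extension" +
  assumes ext: "abelian_extension K A M E" and induces: "induces_bimodule K A M E"
begin

abbreviation "B \<equiv> total E"
abbreviation "\<iota> \<equiv> incl E"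
abbreviation "\<pi> \<equiv> proj E"

sublocale B: compatible_algebra K B
  using ext unfolding abelian_extension_def by blast

lemma incl_hom: "\<iota> \<in> module_hom K M B"
  using ext unfolding abelian_extension_def comp_algebra_hom_def trivial_algebra_def module_hom_def
  by simp

lemma incl_product:
  assumes "m \<in> carrier M" "n \<in> carrier M"
  shows "product B i (\<iota> m) (\<iota> n) = \<iota> \<zero>\<^bsub>M\<^esub>"
proof -
  let ?T = "trivial_algebra M"
  have "\<iota> \<in> comp_algebra_hom K ?T B"
    using ext unfolding abelian_extension_def by blast
  hence hom: "\<forall>a\<in>carrier ?T. \<forall>b\<in>carrier ?T.
      \<iota> (prod1 ?T a b) = prod1 B (\<iota> a) (\<iota> b) \<and> \<iota> (prod2 ?T a b) = prod2 B (\<iota> a) (\<iota> b)"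
    unfolding comp_algebra_hom_def by blast
  have T: "carrier ?T = carrier M" "prod1 ?T m n = \<zero>\<^bsub>M\<^esub>" "prod2 ?T m n = \<zero>\<^bsub>M\<^esub>"
    by (simp_all add: trivial_algebra_def)
  have "\<iota> \<zero>\<^bsub>M\<^esub> = prod1 B (\<iota> m) (\<iota> n)" "\<iota> \<zero>\<^bsub>M\<^esub> = prod2 B (\<iota> m) (\<iota> n)"
    using hom assms unfolding T(1) by (metis T(2), metis T(3))
  thus ?thesis by (cases i) simp_all
qed

lemma inj_incl: "inj_on \<iota> (carrier M)"
  and range_incl: "\<iota> ` carrier M = {b \<in> carrier B. \<pi> b = \<zero>\<^bsub>A\<^esub>}"
  and surj_proj: "\<pi> ` carrier B = carrier A"
  using ext unfolding abelian_extension_def by blast+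

lemma proj_hom: "\<pi> \<in> module_hom K B A"
  using ext unfolding abelian_extension_def comp_algebra_hom_def by blast

lemma proj_product:
  "\<lbrakk>b \<in> carrier B; b' \<in> carrier B\<rbrakk> \<Longrightarrow> \<pi> (product B i b b') = product A i (\<pi> b) (\<pi> b')"
  using ext unfolding abelian_extension_def comp_algebra_hom_def by (cases i) simp_all

sublocale incl: mod_hom K M B \<iota> by unfold_locales (rule incl_hom)
sublocale proj: mod_hom K B A \<pi> by unfold_locales (rule proj_hom)

lemma incl_eq_iff: "\<lbrakk>m \<in> carrier M; n \<in> carrier M\<rbrakk> \<Longrightarrow> \<iota> m = \<iota> n \<longleftrightarrow> m = n"
  using inj_incl by (auto dest: inj_onD)

lemma proj_incl: "m \<in> carrier M \<Longrightarrow> \<pi> (\<iota> m) = \<zero>\<^bsub>A\<^esub>"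
  using range_incl by blast

lemma linear_section_exists: obtains s where "linear_section K A E s"
proof -
  obtain s where "s \<in> module_hom K A B" "\<And>a. a \<in> carrier A \<Longrightarrow> \<pi> (s a) = a"
    by (rule linear_right_inverse_exists[OF B.vectorspace_axioms A.vectorspace_axioms
        A.finite_dimensional proj_hom surj_proj]) blast
  thus ?thesis using that unfolding linear_section_def by blast
qed

end

locale split_extension = inducing_extension K A M E
  for K :: "('k, 'c) ring_scheme" and A :: "('k, 'a, 'y) comp_algebra_scheme"
    and M :: "('k, 'a, 'm, 'z) comp_bimodule_scheme"
    and E :: "('k, 'a, 'm, 'b) extension" +
  fixes s assumes linear_section: "linear_section K A E s"
begin

lemma section_hom: "s \<in> module_hom K A B"
  and proj_section [simp]: "a \<in> carrier A \<Longrightarrow> \<pi> (s a) = a"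
  using linear_section unfolding linear_section_def by auto

sublocale s: mod_hom K A B s by unfold_locales (rule section_hom)

lemma section_incl:
  "\<lbrakk>a \<in> carrier A; m \<in> carrier M\<rbrakk> \<Longrightarrow> product B i (s a) (\<iota> m) = \<iota> (lact M i a m)"
  and incl_section:
  "\<lbrakk>a \<in> carrier A; m \<in> carrier M\<rbrakk> \<Longrightarrow> product B i (\<iota> m) (s a) = \<iota> (ract M i m a)"
proof -
  assume am: "a \<in> carrier A" "m \<in> carrier M"
  note act = induces[unfolded induces_bimodule_def, rule_format, OF linear_section am]
  show "product B i (s a) (\<iota> m) = \<iota> (lact M i a m)"
    "product B i (\<iota> m) (s a) = \<iota> (ract M i m a)"
    using act by (cases i; simp)+
qed

text \<open>The \<open>M\<close>-coordinate of \<open>b\<close> in the decomposition \<open>b = s a + \<iota> m\<close> determined by the section.\<close>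

definition retract :: "'b \<Rightarrow> 'm" where
  "retract b = inv_into (carrier M) \<iota> (b \<ominus>\<^bsub>B\<^esub> s (\<pi> b))"

lemma retract_hom: "retract \<in> module_hom K B M"
proof -
  have h: "(\<lambda>b. b \<oplus>\<^bsub>B\<^esub> \<ominus>\<^bsub>B\<^esub> s (\<pi> b)) \<in> module_hom K B B"
    by (intro B.module_hom_add_pointwise B.module_hom_uminus_pointwise
        module_hom_comp[OF proj_hom section_hom]) (auto simp: module_hom_def)
  have "\<pi> (b \<oplus>\<^bsub>B\<^esub> \<ominus>\<^bsub>B\<^esub> s (\<pi> b)) = \<zero>\<^bsub>A\<^esub>" if "b \<in> carrier B" for b
    using that by (simp add: A.r_neg)
  hence "(\<lambda>b. b \<oplus>\<^bsub>B\<^esub> \<ominus>\<^bsub>B\<^esub> s (\<pi> b)) ` carrier B \<subseteq> \<iota> ` carrier M"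
    unfolding range_incl by auto
  from B.module_hom_inv_into[OF incl_hom inj_incl M.module_axioms h this] show ?thesis
    unfolding retract_def a_minus_def .
qed

sublocale retract: mod_hom K B M retract by unfold_locales (rule retract_hom)

lemma retract_section_add_incl [simp]:
  assumes "a \<in> carrier A" "m \<in> carrier M"
  shows "retract (s a \<oplus>\<^bsub>B\<^esub> \<iota> m) = m"
proof -
  have "(s a \<oplus>\<^bsub>B\<^esub> \<iota> m) \<ominus>\<^bsub>B\<^esub> s (\<pi> (s a \<oplus>\<^bsub>B\<^esub> \<iota> m)) = \<iota> m"
    using assms by (simp add: proj_incl B.add_minus_cancel)
  thus ?thesis unfolding retract_def using assms inj_incl by simp
qed

lemma decompose: "b \<in> carrier B \<Longrightarrow> s (\<pi> b) \<oplus>\<^bsub>B\<^esub> \<iota> (retract b) = b"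
proof -
  assume b: "b \<in> carrier B"
  have "b \<ominus>\<^bsub>B\<^esub> s (\<pi> b) \<in> \<iota> ` carrier M"
    unfolding range_incl using b by (simp add: A.r_neg a_minus_def)
  hence "\<iota> (retract b) = b \<ominus>\<^bsub>B\<^esub> s (\<pi> b)"
    unfolding retract_def by (rule f_inv_into_f)
  thus ?thesis using b by (simp add: B.add_minus_cancel)
qed

lemma section_add_incl_eq_iff:
  assumes "a \<in> carrier A" "m \<in> carrier M" "a' \<in> carrier A" "m' \<in> carrier M"
  shows "s a \<oplus>\<^bsub>B\<^esub> \<iota> m = s a' \<oplus>\<^bsub>B\<^esub> \<iota> m' \<longleftrightarrow> a = a' \<and> m = m'"
proof
  assume eq: "s a \<oplus>\<^bsub>B\<^esub> \<iota> m = s a' \<oplus>\<^bsub>B\<^esub> \<iota> m'"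
  have "\<pi> (s a \<oplus>\<^bsub>B\<^esub> \<iota> m) = a" "\<pi> (s a' \<oplus>\<^bsub>B\<^esub> \<iota> m') = a'"
    using assms by (simp_all add: proj_incl)
  moreover have "m = m'"
    using retract_section_add_incl[OF assms(1,2)] retract_section_add_incl[OF assms(3,4)] eq by metis
  ultimately show "a = a' \<and> m = m'" using eq by metis
qed auto

text \<open>The factor set is the \<open>M\<close>-coordinate of \<open>s a \<cdot>\<^sub>i s b\<close>, whose \<open>A\<close>-coordinate is \<open>a \<cdot>\<^sub>i b\<close>
  since the projection is multiplicative.\<close>

lemma factor_set_exists: obtains fs where "factor_set K A M E s fs"
proof -
  let ?F = "\<lambda>i a b. retract (product B i (s a) (s b))"
  have "bilinear K A A M (?F i)" for i
  proof unfold_locales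
    show "bilinear_map K A A M (?F i)"
      unfolding bilinear_map_def
      by (intro conjI ballI module_hom_comp[OF _ retract_hom] module_hom_comp[OF section_hom]
          B.product.hom_left B.product.hom_right s.f_im)
  qed
  from comp_cochains_2_exists[of ?F, OF this] obtain fs where fs: "fs \<in> comp_cochains K A M 2"
    "\<forall>i. \<forall>a\<in>carrier A. \<forall>b\<in>carrier A. component fs i [a, b] = ?F i a b" by blast
  have "product B i (s a) (s b) = s (product A i a b) \<oplus>\<^bsub>B\<^esub> \<iota> (component fs i [a, b])"
    if "a \<in> carrier A" "b \<in> carrier A" for i a b
    using decompose[of "product B i (s a) (s b)"] fs(2) that by (simp add: proj_product)
  hence "factor_set K A M E s fs"
    unfolding factor_set_def using linear_section fs(1) by blast
  thus ?thesis using that by blast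
qed

end

locale extension_with_factor_set = split_extension K A M E s
  for K :: "('k, 'c) ring_scheme" and A :: "('k, 'a, 'y) comp_algebra_scheme"
    and M :: "('k, 'a, 'm, 'z) comp_bimodule_scheme"
    and E :: "('k, 'a, 'm, 'b) extension" and s +
  fixes fs assumes factor_set: "factor_set K A M E s fs"
begin

lemma comp_cochain: "fs \<in> comp_cochains K A M 2"
  by (rule factor_setD(2)[OF factor_set])

sublocale fs: bilinear K A A M "\<lambda>a b. component fs i [a, b]" for i
  by (rule bilinear_cochain) (rule comp_cochain)

lemma product_section:
  "\<lbrakk>a \<in> carrier A; b \<in> carrier A\<rbrakk> \<Longrightarrow>
    product B i (s a) (s b) = s (product A i a b) \<oplus>\<^bsub>B\<^esub> \<iota> (component fs i [a, b])"
  by (rule factor_setD(3)[OF factor_set])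

text \<open>The factor set and the actions determine the product in coordinates: the mixed terms are given by
  the actions, and products of two elements of \<open>M\<close> vanish.\<close>

lemma product_section_add_incl:
  assumes [simp]: "a \<in> carrier A" "m \<in> carrier M" "b \<in> carrier A" "n \<in> carrier M"
  shows "product B i (s a \<oplus>\<^bsub>B\<^esub> \<iota> m) (s b \<oplus>\<^bsub>B\<^esub> \<iota> n) =
    s (product A i a b) \<oplus>\<^bsub>B\<^esub> \<iota> (lact M i a n \<oplus>\<^bsub>M\<^esub> (ract M i m b \<oplus>\<^bsub>M\<^esub> component fs i [a, b]))"
proof -
  let ?u = "s (product A i a b)" and ?f = "\<iota> (component fs i [a, b])"
    and ?l = "\<iota> (lact M i a n)" and ?r = "\<iota> (ract M i m b)"
  have mem: "?u \<in> carrier B" "?f \<in> carrier B" "?l \<in> carrier B" "?r \<in> carrier B" by simp_all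
  have "product B i (s a \<oplus>\<^bsub>B\<^esub> \<iota> m) (s b \<oplus>\<^bsub>B\<^esub> \<iota> n) = (?u \<oplus>\<^bsub>B\<^esub> ?f \<oplus>\<^bsub>B\<^esub> ?r) \<oplus>\<^bsub>B\<^esub> (?l \<oplus>\<^bsub>B\<^esub> \<zero>\<^bsub>B\<^esub>)"
    by (simp add: product_section section_incl incl_section incl_product)
  also have "\<dots> = ?u \<oplus>\<^bsub>B\<^esub> (?l \<oplus>\<^bsub>B\<^esub> (?r \<oplus>\<^bsub>B\<^esub> ?f))"
    using mem by (simp only: B.a_ac B.r_zero B.a_closed)
  also have "?l \<oplus>\<^bsub>B\<^esub> (?r \<oplus>\<^bsub>B\<^esub> ?f) = \<iota> (lact M i a n \<oplus>\<^bsub>M\<^esub> (ract M i m b \<oplus>\<^bsub>M\<^esub> component fs i [a, b]))"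
    by simp
  finally show ?thesis .
qed

text \<open>Both bracketings of \<open>s a\<close>, \<open>s b\<close>, \<open>s c\<close> are computed in coordinates. The polarised associative law
  of the middle term equates their \<open>M\<close>-coordinates, and this is the cocycle condition.\<close>

lemma factor_set_cocycle: "fs \<in> comp_cocycles K A M 2"
proof -
  have l: "product B i (product B j (s a) (s b)) (s c) =
      s (product A i (product A j a b) c) \<oplus>\<^bsub>B\<^esub>
      \<iota> (ract M i (component fs j [a, b]) c \<oplus>\<^bsub>M\<^esub> component fs i [product A j a b, c])"
    if "a \<in> carrier A" "b \<in> carrier A" "c \<in> carrier A" for i j a b c
    using product_section_add_incl[of "product A j a b" "component fs j [a, b]" c "\<zero>\<^bsub>M\<^esub>" i] that
    by (simp add: product_section)
  have r: "product B i (s a) (product B j (s b) (s c)) =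
      s (product A i a (product A j b c)) \<oplus>\<^bsub>B\<^esub>
      \<iota> (lact M i a (component fs j [b, c]) \<oplus>\<^bsub>M\<^esub> component fs i [a, product A j b c])"
    if "a \<in> carrier A" "b \<in> carrier A" "c \<in> carrier A" for i j a b c
    using product_section_add_incl[of a "\<zero>\<^bsub>M\<^esub>" "product A j b c" "component fs j [b, c]" i] that
    by (simp add: product_section)
  have add: "(s x \<oplus>\<^bsub>B\<^esub> \<iota> m) \<oplus>\<^bsub>B\<^esub> (s y \<oplus>\<^bsub>B\<^esub> \<iota> n) = s (x \<oplus>\<^bsub>A\<^esub> y) \<oplus>\<^bsub>B\<^esub> \<iota> (m \<oplus>\<^bsub>M\<^esub> n)"
    if "x \<in> carrier A" "y \<in> carrier A" "m \<in> carrier M" "n \<in> carrier M" for x y m n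
    using that by (simp add: B.a_ac)
  have "(ract M i (component fs j [a, b]) c \<oplus>\<^bsub>M\<^esub> component fs i [product A j a b, c]) \<oplus>\<^bsub>M\<^esub>
       (ract M j (component fs i [a, b]) c \<oplus>\<^bsub>M\<^esub> component fs j [product A i a b, c]) =
       (lact M i a (component fs j [b, c]) \<oplus>\<^bsub>M\<^esub> component fs i [a, product A j b c]) \<oplus>\<^bsub>M\<^esub>
       (lact M j a (component fs i [b, c]) \<oplus>\<^bsub>M\<^esub> component fs j [a, product A i b c])"
    if abc [simp]: "a \<in> carrier A" "b \<in> carrier A" "c \<in> carrier A" for i j a b c
    using B.polarised_assoc[of "s a" "s b" "s c" i j]
    by (simp add: l r add section_add_incl_eq_iff del: s.f_add incl.f_add)
  thus ?thesis
    unfolding comp_cocycles_2_iff using comp_cochain by blast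
qed

lemma factor_set_unique:
  assumes s': "factor_set K A M E s' fs'" and eq: "\<And>a. a \<in> carrier A \<Longrightarrow> s' a = s a"
  shows "fs' = fs"
proof -
  have fs': "fs' \<in> comp_cochains K A M 2" by (rule factor_setD(2)[OF s'])
  have "component fs' i [a, b] = component fs i [a, b]"
    if ab: "a \<in> carrier A" "b \<in> carrier A" for i a b
  proof -
    have "product B i (s' a) (s' b) = s' (product A i a b) \<oplus>\<^bsub>B\<^esub> \<iota> (component fs' i [a, b])"
      by (rule factor_setD(3)[OF s' ab])
    hence "s (product A i a b) \<oplus>\<^bsub>B\<^esub> \<iota> (component fs' i [a, b]) =
        s (product A i a b) \<oplus>\<^bsub>B\<^esub> \<iota> (component fs i [a, b])"
      using product_section[OF ab, of i] by (simp only: eq ab A.product.closed)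
    thus ?thesis
      using ab cochain_2_closed[OF fs' ab] by (simp add: section_add_incl_eq_iff incl_eq_iff)
  qed
  thus ?thesis by (rule comp_cochains_2_eqI[OF fs' comp_cochain])
qed

text \<open>Changing the section by \<open>\<iota> g\<close> adds \<open>a \<cdot>\<^sub>i g b + g a \<cdot>\<^sub>i b\<close> to the defect of multiplicativity, by the
  product formula, and subtracts \<open>g (a \<cdot>\<^sub>i b)\<close>, because \<open>s (a \<cdot>\<^sub>i b)\<close> is replaced by the value of the new section.\<close>

lemma factor_set_add_coboundary:
  assumes g: "g \<in> cochains K A M 1"
  shows "factor_set K A M E (\<lambda>a. s a \<oplus>\<^bsub>B\<^esub> \<iota> (g [a])) (add_coboundary g fs)"
proof -
  note [simp] = cochain_1_closed[OF g]
  have "(\<lambda>a. s a \<oplus>\<^bsub>B\<^esub> \<iota> (g [a])) \<in> module_hom K A B"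
    by (intro B.module_hom_add_pointwise section_hom module_hom_comp[OF cochain_1_hom[OF g] incl_hom])
  hence "linear_section K A E (\<lambda>a. s a \<oplus>\<^bsub>B\<^esub> \<iota> (g [a]))"
    unfolding linear_section_def by (simp add: proj_incl)
  moreover have "product B i (s a \<oplus>\<^bsub>B\<^esub> \<iota> (g [a])) (s b \<oplus>\<^bsub>B\<^esub> \<iota> (g [b])) =
      (s (product A i a b) \<oplus>\<^bsub>B\<^esub> \<iota> (g [product A i a b])) \<oplus>\<^bsub>B\<^esub> \<iota> (component (add_coboundary g fs) i [a, b])"
    if [simp]: "a \<in> carrier A" "b \<in> carrier A" for i a b
  proof -
    let ?l = "lact M i a (g [b])" and ?r = "ract M i (g [a]) b" and ?m = "g [product A i a b]"
      and ?f = "component fs i [a, b]"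
    have "?m \<oplus>\<^bsub>M\<^esub> ((?l \<oplus>\<^bsub>M\<^esub> \<ominus>\<^bsub>M\<^esub> ?m \<oplus>\<^bsub>M\<^esub> ?r) \<oplus>\<^bsub>M\<^esub> ?f) = ?m \<oplus>\<^bsub>M\<^esub> (\<ominus>\<^bsub>M\<^esub> ?m \<oplus>\<^bsub>M\<^esub> (?l \<oplus>\<^bsub>M\<^esub> (?r \<oplus>\<^bsub>M\<^esub> ?f)))"
      by (simp add: M.a_ac)
    also have "\<dots> = ?l \<oplus>\<^bsub>M\<^esub> (?r \<oplus>\<^bsub>M\<^esub> ?f)" by (rule M.r_neg2) simp_all
    finally have m: "?m \<oplus>\<^bsub>M\<^esub> component (add_coboundary g fs) i [a, b] = ?l \<oplus>\<^bsub>M\<^esub> (?r \<oplus>\<^bsub>M\<^esub> ?f)"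
      using component_add_coboundary[OF g comp_cochain that] by simp
    have "component (add_coboundary g fs) i [a, b] \<in> carrier M"
      using cochain_2_closed[OF add_coboundary_closed[OF g comp_cochain]] by simp
    thus ?thesis
      unfolding product_section_add_incl[OF that(1) cochain_1_closed[OF g that(1)] that(2) cochain_1_closed[OF g that(2)]]
      by (simp add: m[symmetric] B.a_assoc)
  qed
  ultimately show ?thesis
    unfolding factor_set_def using add_coboundary_closed[OF g comp_cochain] by blast
qed

text \<open>The \<open>M\<close>-coordinate of a second section \<open>s'\<close> is the linear map \<open>g\<close> with \<open>s' = s + \<iota> g\<close>.\<close>

lemma factor_set_eq_add_coboundary:
  assumes s': "factor_set K A M E s' fs'"
  shows "\<exists>g\<in>cochains K A M 1. fs' = add_coboundary g fs"
proof -
  interpret t: extension_with_factor_set K A M E s' fs'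
    by unfold_locales (rule factor_setD(1)[OF s'], rule s')
  define g where "g = (\<lambda>xs\<in>tuples A 1. retract (s' (xs ! 0)))"
  have g_val: "g [a] = retract (s' a)" if "a \<in> carrier A" for a
    unfolding g_def using that by (simp add: tuples_def)
  have "(\<lambda>a. retract (s' a)) \<in> module_hom K A M"
    by (rule module_hom_comp[OF t.section_hom retract_hom])
  hence "(\<lambda>a. g [a]) \<in> module_hom K A M"
    unfolding module_hom_def Pi_def by (auto simp: g_val)
  hence g: "g \<in> cochains K A M 1"
    unfolding cochains_1_iff by (simp add: g_def)
  have eq: "s' a = s a \<oplus>\<^bsub>B\<^esub> \<iota> (g [a])" if a: "a \<in> carrier A" for a
    using decompose[OF t.s.f_im[OF a]] unfolding g_val[OF a] t.proj_section[OF a] by (rule sym)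
  interpret u: extension_with_factor_set K A M E "\<lambda>a. s a \<oplus>\<^bsub>B\<^esub> \<iota> (g [a])" "add_coboundary g fs"
    by unfold_locales (rule factor_setD(1)[OF factor_set_add_coboundary[OF g]], rule factor_set_add_coboundary[OF g])
  have "fs' = add_coboundary g fs"
    by (rule u.factor_set_unique[OF s' eq])
  thus ?thesis using g by blast
qed

lemma factor_set_iff_add_coboundary:
  "(\<exists>s'. factor_set K A M E s' fs') \<longleftrightarrow> (\<exists>g\<in>cochains K A M 1. fs' = add_coboundary g fs)"
proof
  assume "\<exists>s'. factor_set K A M E s' fs'"
  then obtain s' where "factor_set K A M E s' fs'" ..
  thus "\<exists>g\<in>cochains K A M 1. fs' = add_coboundary g fs" by (rule factor_set_eq_add_coboundary)
next
  assume "\<exists>g\<in>cochains K A M 1. fs' = add_coboundary g fs"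
  then obtain g where g: "g \<in> cochains K A M 1" "fs' = add_coboundary g fs" ..
  have "factor_set K A M E (\<lambda>a. s a \<oplus>\<^bsub>B\<^esub> \<iota> (g [a])) fs'"
    unfolding g(2) by (rule factor_set_add_coboundary[OF g(1)])
  thus "\<exists>s'. factor_set K A M E s' fs'" by (rule exI[of "\<lambda>s'. factor_set K A M E s' fs'"])
qed

end

section \<open>Equivalence of extensions\<close>

context extension_with_factor_set
begin

text \<open>The map \<open>s a + \<iota> m \<mapsto> s' a + \<iota>' m\<close> is multiplicative because, by the product formula, the
  products in these coordinates depend on the factor set alone.\<close>

lemma equivalent_if_common_factor_set:
  assumes "extension_with_factor_set K A M E' s' fs"
  shows "equivalent_extensions K M E E'"
proof -
  interpret t: extension_with_factor_set K A M E' s' fs by fact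
  define \<phi> where "\<phi> b = s' (\<pi> b) \<oplus>\<^bsub>t.B\<^esub> t.\<iota> (retract b)" for b
  have hom: "\<phi> \<in> module_hom K B t.B"
    unfolding \<phi>_def
    by (intro t.B.module_hom_add_pointwise module_hom_comp[OF proj_hom t.section_hom]
        module_hom_comp[OF retract_hom t.incl_hom])
  have val: "\<phi> (s a \<oplus>\<^bsub>B\<^esub> \<iota> m) = s' a \<oplus>\<^bsub>t.B\<^esub> t.\<iota> m" if "a \<in> carrier A" "m \<in> carrier M" for a m
    unfolding \<phi>_def retract_section_add_incl[OF that] using that by (simp add: proj_incl)
  have mult: "\<phi> (product B i b b') = product t.B i (\<phi> b) (\<phi> b')"
    if b: "b \<in> carrier B" and b': "b' \<in> carrier B" for i b b'
  proof -
    have "\<phi> (product B i (s (\<pi> b) \<oplus>\<^bsub>B\<^esub> \<iota> (retract b)) (s (\<pi> b') \<oplus>\<^bsub>B\<^esub> \<iota> (retract b'))) =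
        product t.B i (s' (\<pi> b) \<oplus>\<^bsub>t.B\<^esub> t.\<iota> (retract b)) (s' (\<pi> b') \<oplus>\<^bsub>t.B\<^esub> t.\<iota> (retract b'))"
      using b b' by (simp only: product_section_add_incl t.product_section_add_incl val proj.f_im
          retract.f_im A.product.closed lact.closed ract.closed fs.closed M.a_closed)
    thus ?thesis unfolding decompose[OF b] decompose[OF b'] by (simp only: \<phi>_def)
  qed
  have "\<phi> \<in> comp_algebra_hom K B t.B"
    unfolding comp_algebra_hom_def using hom mult[of _ _ L1] mult[of _ _ L2] by simp
  moreover have "\<phi> (\<iota> m) = t.\<iota> m" if "m \<in> carrier M" for m
    using val[of "\<zero>\<^bsub>A\<^esub>" m] that by simp
  moreover have "t.\<pi> (\<phi> b) = \<pi> b" if "b \<in> carrier B" for b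
    unfolding \<phi>_def using that by (simp add: t.proj_incl)
  ultimately show ?thesis unfolding equivalent_extensions_def by blast
qed

text \<open>An equivalence \<open>\<phi>\<close> takes the section \<open>s\<close> to the section \<open>\<phi> \<circ> s\<close>, and applying \<open>\<phi>\<close> to the
  equation defining the factor set of \<open>s\<close> gives the one for \<open>\<phi> \<circ> s\<close>.\<close>

lemma equivalent_has_same_factor_set:
  assumes "inducing_extension K A M E'" and eq: "equivalent_extensions K M E E'"
  obtains s' where "factor_set K A M E' s' fs"
proof -
  interpret t: inducing_extension K A M E' by fact
  obtain \<phi> where \<phi>: "\<phi> \<in> comp_algebra_hom K B t.B"
    and incl: "\<And>m. m \<in> carrier M \<Longrightarrow> \<phi> (\<iota> m) = t.\<iota> m"
    and proj: "\<And>b. b \<in> carrier B \<Longrightarrow> t.\<pi> (\<phi> b) = \<pi> b"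
    using eq unfolding equivalent_extensions_def by blast
  have hom: "\<phi> \<in> module_hom K B t.B" using \<phi> unfolding comp_algebra_hom_def by blast
  interpret \<phi>: mod_hom K B t.B \<phi> using hom by unfold_locales
  have mult: "\<phi> (product B i b b') = product t.B i (\<phi> b) (\<phi> b')"
    if "b \<in> carrier B" "b' \<in> carrier B" for i b b'
    using \<phi> that unfolding comp_algebra_hom_def by (cases i) simp_all
  have "(\<lambda>a. \<phi> (s a)) \<in> module_hom K A t.B" by (rule module_hom_comp[OF section_hom hom])
  hence "linear_section K A E' (\<lambda>a. \<phi> (s a))"
    unfolding linear_section_def by (simp add: proj)
  moreover have "product t.B i (\<phi> (s a)) (\<phi> (s b)) =
      \<phi> (s (product A i a b)) \<oplus>\<^bsub>t.B\<^esub> t.\<iota> (component fs i [a, b])"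
    if ab: "a \<in> carrier A" "b \<in> carrier A" for i a b
  proof -
    have "product t.B i (\<phi> (s a)) (\<phi> (s b)) = \<phi> (product B i (s a) (s b))"
      using ab by (simp only: mult s.f_im)
    also have "\<dots> = \<phi> (s (product A i a b)) \<oplus>\<^bsub>t.B\<^esub> \<phi> (\<iota> (component fs i [a, b]))"
      unfolding product_section[OF ab] using ab by (intro \<phi>.f_add) simp_all
    finally show ?thesis using ab by (simp only: incl fs.closed)
  qed
  ultimately have "factor_set K A M E' (\<lambda>a. \<phi> (s a)) fs"
    unfolding factor_set_def using comp_cochain by blast
  thus ?thesis by (rule that)
qed

end

section \<open>The extension twisted by a cocycle\<close>

text \<open>Both sums collect the \<open>M\<close>-coordinates of triple products in a twisted extension, one for each
  bracketing. Regrouped, each pair of summands is a side of one bimodule law or of the cocycle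
  condition.\<close>

lemma (in abelian_monoid) regroup_triple_products:
  assumes [simp]: "l \<in> carrier G" "x \<in> carrier G" "r \<in> carrier G" "g \<in> carrier G" "h \<in> carrier G"
    "l' \<in> carrier G" "x' \<in> carrier G" "r' \<in> carrier G" "g' \<in> carrier G" "h' \<in> carrier G"
  shows "(l \<oplus> ((x \<oplus> (r \<oplus> g)) \<oplus> h)) \<oplus> (l' \<oplus> ((x' \<oplus> (r' \<oplus> g')) \<oplus> h')) =
      (l \<oplus> l') \<oplus> ((x \<oplus> x') \<oplus> ((r \<oplus> r') \<oplus> ((g \<oplus> h) \<oplus> (g' \<oplus> h'))))"
    and "((l \<oplus> (x \<oplus> g)) \<oplus> (r \<oplus> h)) \<oplus> ((l' \<oplus> (x' \<oplus> g')) \<oplus> (r' \<oplus> h')) =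
      (l \<oplus> l') \<oplus> ((x \<oplus> x') \<oplus> ((r \<oplus> r') \<oplus> ((g \<oplus> h) \<oplus> (g' \<oplus> h'))))"
  by (simp_all add: a_ac)

text \<open>The injection \<open>e\<close> transports the direct sum of \<open>A\<close> and \<open>M\<close> into the type that holds the middle
  terms.\<close>

locale twisted_extension = algebra_with_bimodule K A M
  for K :: "('k, 'c) ring_scheme" and A :: "('k, 'a, 'y) comp_algebra_scheme"
    and M :: "('k, 'a, 'm, 'z) comp_bimodule_scheme" +
  fixes e :: "'a \<times> 'm \<Rightarrow> 'b" and fs
  assumes inj: "inj_on e (carrier A \<times> carrier M)" and cocycle: "fs \<in> comp_cocycles K A M 2"
begin

definition fstA :: "'b \<Rightarrow> 'a" where "fstA x = fst (inv_into (carrier A \<times> carrier M) e x)"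
definition sndM :: "'b \<Rightarrow> 'm" where "sndM x = snd (inv_into (carrier A \<times> carrier M) e x)"

lemma fstA_e [simp]: "\<lbrakk>a \<in> carrier A; m \<in> carrier M\<rbrakk> \<Longrightarrow> fstA (e (a, m)) = a"
  and sndM_e [simp]: "\<lbrakk>a \<in> carrier A; m \<in> carrier M\<rbrakk> \<Longrightarrow> sndM (e (a, m)) = m"
  unfolding fstA_def sndM_def using inj by (simp_all add: inv_into_f_f)

definition twisted_product :: "label \<Rightarrow> 'b \<Rightarrow> 'b \<Rightarrow> 'b" where
  "twisted_product i x y = e (product A i (fstA x) (fstA y),
     lact M i (fstA x) (sndM y) \<oplus>\<^bsub>M\<^esub> (ract M i (sndM x) (fstA y) \<oplus>\<^bsub>M\<^esub> component fs i [fstA x, fstA y]))"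

definition twisted_algebra :: "('k, 'b) comp_algebra" where
  "twisted_algebra = \<lparr>carrier = e ` (carrier A \<times> carrier M), mult = undefined, one = undefined,
     zero = e (\<zero>\<^bsub>A\<^esub>, \<zero>\<^bsub>M\<^esub>),
     add = (\<lambda>x y. e (fstA x \<oplus>\<^bsub>A\<^esub> fstA y, sndM x \<oplus>\<^bsub>M\<^esub> sndM y)),
     smult = (\<lambda>k x. e (k \<odot>\<^bsub>A\<^esub> fstA x, k \<odot>\<^bsub>M\<^esub> sndM x)),
     prod1 = twisted_product L1, prod2 = twisted_product L2\<rparr>"

abbreviation "T \<equiv> twisted_algebra"

definition twisted :: "('k, 'a, 'm, 'b) extension" where
  "twisted = \<lparr>total = T, incl = (\<lambda>m. e (\<zero>\<^bsub>A\<^esub>, m)), proj = fstA\<rparr>"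

lemma comp_cochain: "fs \<in> comp_cochains K A M 2"
  using cocycle unfolding comp_cocycles_2_iff by blast

sublocale fs: bilinear K A A M "\<lambda>a b. component fs i [a, b]" for i
  by (rule bilinear_cochain) (rule comp_cochain)

lemma carrier_T: "carrier T = e ` (carrier A \<times> carrier M)"
  and zero_T: "\<zero>\<^bsub>T\<^esub> = e (\<zero>\<^bsub>A\<^esub>, \<zero>\<^bsub>M\<^esub>)"
  by (simp_all add: twisted_algebra_def)

lemma e_closed [simp]: "\<lbrakk>a \<in> carrier A; m \<in> carrier M\<rbrakk> \<Longrightarrow> e (a, m) \<in> carrier T"
  unfolding carrier_T by blast

lemma T_cases:
  assumes "x \<in> carrier T" obtains a m where "a \<in> carrier A" "m \<in> carrier M" "x = e (a, m)"
  using assms unfolding carrier_T by blast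

lemma e_eq_iff: "\<lbrakk>a \<in> carrier A; m \<in> carrier M; b \<in> carrier A; n \<in> carrier M\<rbrakk> \<Longrightarrow>
    e (a, m) = e (b, n) \<longleftrightarrow> a = b \<and> m = n"
  by (metis fstA_e sndM_e)

lemma add_T [simp]: "\<lbrakk>a \<in> carrier A; m \<in> carrier M; b \<in> carrier A; n \<in> carrier M\<rbrakk> \<Longrightarrow>
    e (a, m) \<oplus>\<^bsub>T\<^esub> e (b, n) = e (a \<oplus>\<^bsub>A\<^esub> b, m \<oplus>\<^bsub>M\<^esub> n)"
  by (simp add: twisted_algebra_def)

lemma smult_T [simp]: "\<lbrakk>k \<in> carrier K; a \<in> carrier A; m \<in> carrier M\<rbrakk> \<Longrightarrow>
    k \<odot>\<^bsub>T\<^esub> e (a, m) = e (k \<odot>\<^bsub>A\<^esub> a, k \<odot>\<^bsub>M\<^esub> m)"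
  by (simp add: twisted_algebra_def)

lemma product_T [simp]: "\<lbrakk>a \<in> carrier A; m \<in> carrier M; b \<in> carrier A; n \<in> carrier M\<rbrakk> \<Longrightarrow>
    product T i (e (a, m)) (e (b, n)) = e (product A i a b,
      lact M i a n \<oplus>\<^bsub>M\<^esub> (ract M i m b \<oplus>\<^bsub>M\<^esub> component fs i [a, b]))"
  by (cases i) (simp_all add: twisted_algebra_def twisted_product_def)

lemma module_T: "module K T"
proof (rule module_criteria)
  show "cring K" by (rule A.is_cring)
  show "\<zero>\<^bsub>T\<^esub> \<in> carrier T" by (simp add: zero_T)
  show "\<forall>v w. v \<in> carrier T \<and> w \<in> carrier T \<longrightarrow> v \<oplus>\<^bsub>T\<^esub> w \<in> carrier T"
    by (auto elim!: T_cases)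
  show "\<forall>v\<in>carrier T. \<exists>n\<in>carrier T. v \<oplus>\<^bsub>T\<^esub> n = \<zero>\<^bsub>T\<^esub>"
  proof
    fix v assume "v \<in> carrier T"
    then obtain a m where v: "a \<in> carrier A" "m \<in> carrier M" "v = e (a, m)" by (rule T_cases)
    hence "v \<oplus>\<^bsub>T\<^esub> e (\<ominus>\<^bsub>A\<^esub> a, \<ominus>\<^bsub>M\<^esub> m) = \<zero>\<^bsub>T\<^esub>" by (simp add: zero_T A.r_neg M.r_neg)
    thus "\<exists>n\<in>carrier T. v \<oplus>\<^bsub>T\<^esub> n = \<zero>\<^bsub>T\<^esub>"
      using v by (intro bexI[of _ "e (\<ominus>\<^bsub>A\<^esub> a, \<ominus>\<^bsub>M\<^esub> m)"]) simp_all
  qed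
  show "\<forall>c v. c \<in> carrier K \<and> v \<in> carrier T \<longrightarrow> c \<odot>\<^bsub>T\<^esub> v \<in> carrier T"
    by (auto elim!: T_cases)
  show "\<forall>v w. v \<in> carrier T \<and> w \<in> carrier T \<longrightarrow> v \<oplus>\<^bsub>T\<^esub> w = w \<oplus>\<^bsub>T\<^esub> v"
    by (auto elim!: T_cases simp: A.a_comm M.a_comm)
  show "\<forall>v w x. v \<in> carrier T \<and> w \<in> carrier T \<and> x \<in> carrier T \<longrightarrow>
      v \<oplus>\<^bsub>T\<^esub> w \<oplus>\<^bsub>T\<^esub> x = v \<oplus>\<^bsub>T\<^esub> (w \<oplus>\<^bsub>T\<^esub> x)"
    by (auto elim!: T_cases simp: A.a_assoc M.a_assoc)
  show "\<forall>v\<in>carrier T. v \<oplus>\<^bsub>T\<^esub> \<zero>\<^bsub>T\<^esub> = v"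
    by (auto elim!: T_cases simp: zero_T)
  show "\<forall>a b v. a \<in> carrier K \<and> b \<in> carrier K \<and> v \<in> carrier T \<longrightarrow>
      (a \<otimes>\<^bsub>K\<^esub> b) \<odot>\<^bsub>T\<^esub> v = a \<odot>\<^bsub>T\<^esub> (b \<odot>\<^bsub>T\<^esub> v)"
    by (auto elim!: T_cases simp: A.smult_assoc1 M.smult_assoc1)
  show "\<forall>v\<in>carrier T. \<one>\<^bsub>K\<^esub> \<odot>\<^bsub>T\<^esub> v = v"
    by (auto elim!: T_cases)
  show "\<forall>a b v. a \<in> carrier K \<and> b \<in> carrier K \<and> v \<in> carrier T \<longrightarrow>
      (a \<oplus>\<^bsub>K\<^esub> b) \<odot>\<^bsub>T\<^esub> v = a \<odot>\<^bsub>T\<^esub> v \<oplus>\<^bsub>T\<^esub> b \<odot>\<^bsub>T\<^esub> v"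
    by (auto elim!: T_cases simp: A.smult_l_distr M.smult_l_distr)
  show "\<forall>a v w. a \<in> carrier K \<and> v \<in> carrier T \<and> w \<in> carrier T \<longrightarrow>
      a \<odot>\<^bsub>T\<^esub> (v \<oplus>\<^bsub>T\<^esub> w) = a \<odot>\<^bsub>T\<^esub> v \<oplus>\<^bsub>T\<^esub> a \<odot>\<^bsub>T\<^esub> w"
    by (auto elim!: T_cases simp: A.smult_r_distr M.smult_r_distr)
qed

lemma incl_hom_T: "(\<lambda>m. e (\<zero>\<^bsub>A\<^esub>, m)) \<in> module_hom K M T"
  and section_hom_T: "(\<lambda>a. e (a, \<zero>\<^bsub>M\<^esub>)) \<in> module_hom K A T"
  and proj_hom_T: "fstA \<in> module_hom K T A"
  unfolding module_hom_def by (auto elim!: T_cases)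

sublocale T: vectorspace K T
  by (intro vectorspace.intro module_T A.field_axioms)

lemma fin_dim_T: "T.fin_dim"
proof (rule T.fin_dim_if_sum_of_images[OF A.vectorspace_axioms A.finite_dimensional section_hom_T
      M.vectorspace_axioms M.finite_dimensional incl_hom_T])
  fix v assume "v \<in> carrier T"
  then obtain a m where "a \<in> carrier A" "m \<in> carrier M" "v = e (a, m)" by (rule T_cases)
  thus "\<exists>a\<in>carrier A. \<exists>m\<in>carrier M. v = e (a, \<zero>\<^bsub>M\<^esub>) \<oplus>\<^bsub>T\<^esub> e (\<zero>\<^bsub>A\<^esub>, m)"
    by (intro bexI[of _ a] bexI[of _ m]) simp_all
qed

lemma bilinear_product_T: "bilinear_map K T T T (product T i)"
  unfolding bilinear_map_def module_hom_def
  by (auto elim!: T_cases simp: M.a_ac M.smult_r_distr)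

text \<open>The \<open>A\<close>-coordinates agree by the polarised law of \<open>A\<close>. The \<open>M\<close>-coordinates split into four pairs:
  three agree by the bimodule laws, the fourth by the cocycle condition.\<close>

lemma polarised_assoc_T:
  assumes "x \<in> carrier T" "y \<in> carrier T" "z \<in> carrier T"
  shows "product T i (product T j x y) z \<oplus>\<^bsub>T\<^esub> product T j (product T i x y) z =
    product T i x (product T j y z) \<oplus>\<^bsub>T\<^esub> product T j x (product T i y z)"
proof -
  obtain a m where x: "x = e (a, m)" and [simp]: "a \<in> carrier A" "m \<in> carrier M"
    using assms(1) by (rule T_cases)
  obtain b n where y: "y = e (b, n)" and [simp]: "b \<in> carrier A" "n \<in> carrier M"
    using assms(2) by (rule T_cases)
  obtain c p where z: "z = e (c, p)" and [simp]: "c \<in> carrier A" "p \<in> carrier M"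
    using assms(3) by (rule T_cases)
  let ?f = "\<lambda>i a b. component fs i [a, b]"
  let ?L = "\<lambda>i j. lact M i (product A j a b) p \<oplus>\<^bsub>M\<^esub> ((ract M i (lact M j a n) c \<oplus>\<^bsub>M\<^esub>
    (ract M i (ract M j m b) c \<oplus>\<^bsub>M\<^esub> ract M i (?f j a b) c)) \<oplus>\<^bsub>M\<^esub> ?f i (product A j a b) c)"
  let ?R = "\<lambda>i j. (lact M i a (lact M j b p) \<oplus>\<^bsub>M\<^esub> (lact M i a (ract M j n c) \<oplus>\<^bsub>M\<^esub>
    lact M i a (?f j b c))) \<oplus>\<^bsub>M\<^esub> (ract M i m (product A j b c) \<oplus>\<^bsub>M\<^esub> ?f i a (product A j b c))"
  have L: "product T i (product T j x y) z = e (product A i (product A j a b) c, ?L i j)" for i j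
    by (simp add: x y z)
  have R: "product T i x (product T j y z) = e (product A i a (product A j b c), ?R i j)" for i j
    by (simp add: x y z)
  have f: "(ract M i (?f j a b) c \<oplus>\<^bsub>M\<^esub> ?f i (product A j a b) c) \<oplus>\<^bsub>M\<^esub>
       (ract M j (?f i a b) c \<oplus>\<^bsub>M\<^esub> ?f j (product A i a b) c) =
       (lact M i a (?f j b c) \<oplus>\<^bsub>M\<^esub> ?f i a (product A j b c)) \<oplus>\<^bsub>M\<^esub>
       (lact M j a (?f i b c) \<oplus>\<^bsub>M\<^esub> ?f j a (product A i b c))"
    using cocycle[unfolded comp_cocycles_2_iff] by simp
  have "?L i j \<oplus>\<^bsub>M\<^esub> ?L j i = ?R i j \<oplus>\<^bsub>M\<^esub> ?R j i"
  proof -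
    note closed = lact.closed ract.closed fs.closed A.product.closed
      \<open>a \<in> carrier A\<close> \<open>b \<in> carrier A\<close> \<open>c \<in> carrier A\<close> \<open>m \<in> carrier M\<close> \<open>n \<in> carrier M\<close> \<open>p \<in> carrier M\<close>
    have "?L i j \<oplus>\<^bsub>M\<^esub> ?L j i =
        (lact M i (product A j a b) p \<oplus>\<^bsub>M\<^esub> lact M j (product A i a b) p) \<oplus>\<^bsub>M\<^esub>
        ((ract M i (lact M j a n) c \<oplus>\<^bsub>M\<^esub> ract M j (lact M i a n) c) \<oplus>\<^bsub>M\<^esub>
        ((ract M i (ract M j m b) c \<oplus>\<^bsub>M\<^esub> ract M j (ract M i m b) c) \<oplus>\<^bsub>M\<^esub>
        ((ract M i (?f j a b) c \<oplus>\<^bsub>M\<^esub> ?f i (product A j a b) c) \<oplus>\<^bsub>M\<^esub>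
         (ract M j (?f i a b) c \<oplus>\<^bsub>M\<^esub> ?f j (product A i a b) c))))"
      by (rule M.regroup_triple_products(1)) (intro closed)+
    also have "\<dots> = ?R i j \<oplus>\<^bsub>M\<^esub> ?R j i"
      unfolding f lact_lact[OF closed(5,6,10)] lact_ract[OF closed(5,7,9)] ract_ract[OF closed(6,7,8)]
      by (rule M.regroup_triple_products(2)[symmetric]) (intro closed)+
    finally show ?thesis .
  qed
  thus ?thesis
    unfolding L R using A.polarised_assoc[of a b c i j] by simp
qed

lemma compatible_algebra_T: "compatible_algebra K T"
proof (rule compatible_algebraI_polarised)
  show "fd_vectorspace K T"
    using fin_dim_T by unfold_locales
qed (rule bilinear_product_T, rule polarised_assoc_T)

lemma twisted_simps [simp]:
  "total twisted = T" "incl twisted = (\<lambda>m. e (\<zero>\<^bsub>A\<^esub>, m))" "proj twisted = fstA"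
  by (simp_all add: twisted_def)

lemma abelian_extension_twisted: "abelian_extension K A M twisted"
  unfolding abelian_extension_def twisted_simps
proof (intro conjI)
  show "compatible_algebra K T" by (rule compatible_algebra_T)
  have "(\<lambda>m. e (\<zero>\<^bsub>A\<^esub>, m)) \<in> module_hom K (trivial_algebra M) T"
    using incl_hom_T unfolding module_hom_def trivial_algebra_def by simp
  moreover have zero: "product T i (e (\<zero>\<^bsub>A\<^esub>, m)) (e (\<zero>\<^bsub>A\<^esub>, n)) = e (\<zero>\<^bsub>A\<^esub>, \<zero>\<^bsub>M\<^esub>)"
    if "m \<in> carrier M" "n \<in> carrier M" for i m n
    using that by simp
  have "prod1 T (e (\<zero>\<^bsub>A\<^esub>, m)) (e (\<zero>\<^bsub>A\<^esub>, n)) = e (\<zero>\<^bsub>A\<^esub>, \<zero>\<^bsub>M\<^esub>)"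
    "prod2 T (e (\<zero>\<^bsub>A\<^esub>, m)) (e (\<zero>\<^bsub>A\<^esub>, n)) = e (\<zero>\<^bsub>A\<^esub>, \<zero>\<^bsub>M\<^esub>)"
    if "m \<in> carrier M" "n \<in> carrier M" for m n
    using zero[OF that, of L1] zero[OF that, of L2] by (simp_all only: product.simps)
  ultimately show "(\<lambda>m. e (\<zero>\<^bsub>A\<^esub>, m)) \<in> comp_algebra_hom K (trivial_algebra M) T"
    unfolding comp_algebra_hom_def by (simp add: trivial_algebra_def)
  have hom: "fstA (product T i x y) = product A i (fstA x) (fstA y)"
    if "x \<in> carrier T" "y \<in> carrier T" for i x y
    using that by (auto elim!: T_cases)
  have "fstA (prod1 T x y) = prod1 A (fstA x) (fstA y)" "fstA (prod2 T x y) = prod2 A (fstA x) (fstA y)"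
    if "x \<in> carrier T" "y \<in> carrier T" for x y
    using hom[OF that, of L1] hom[OF that, of L2] by (simp_all only: product.simps)
  thus "fstA \<in> comp_algebra_hom K T A"
    unfolding comp_algebra_hom_def using proj_hom_T by simp
  show "inj_on (\<lambda>m. e (\<zero>\<^bsub>A\<^esub>, m)) (carrier M)"
    by (auto simp: inj_on_def e_eq_iff)
  show "(\<lambda>m. e (\<zero>\<^bsub>A\<^esub>, m)) ` carrier M = {x \<in> carrier T. fstA x = \<zero>\<^bsub>A\<^esub>}"
    by (auto elim!: T_cases)
  show "fstA ` carrier T = carrier A"
  proof
    show "fstA ` carrier T \<subseteq> carrier A" by (auto elim!: T_cases)
    show "carrier A \<subseteq> fstA ` carrier T"
    proof
      fix a assume "a \<in> carrier A"
      thus "a \<in> fstA ` carrier T" by (intro image_eqI[of _ _ "e (a, \<zero>\<^bsub>M\<^esub>)"]) simp_all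
    qed
  qed
qed

text \<open>A section may have a nonzero \<open>M\<close>-coordinate \<open>g\<close>, but in a product with an element of \<open>M\<close> that
  coordinate is multiplied by the \<open>A\<close>-coordinate 0.\<close>

lemma induces_bimodule_twisted: "induces_bimodule K A M twisted"
  unfolding induces_bimodule_def twisted_simps
proof (intro allI impI ballI)
  fix s a m assume s: "linear_section K A twisted s" and am [simp]: "a \<in> carrier A" "m \<in> carrier M"
  have "s a \<in> carrier T" "fstA (s a) = a"
    using s am(1) unfolding linear_section_def module_hom_def by auto
  then obtain g where g: "s a = e (a, g)" "g \<in> carrier M"
    by (metis T_cases fstA_e)
  have l: "product T i (s a) (e (\<zero>\<^bsub>A\<^esub>, m)) = e (\<zero>\<^bsub>A\<^esub>, lact M i a m)"
    and r: "product T i (e (\<zero>\<^bsub>A\<^esub>, m)) (s a) = e (\<zero>\<^bsub>A\<^esub>, ract M i m a)" for i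
    using g(2) unfolding g(1) by simp_all
  show "e (\<zero>\<^bsub>A\<^esub>, a \<rhd>\<^sub>1\<^bsub>M\<^esub> m) = s a \<cdot>\<^sub>1\<^bsub>T\<^esub> e (\<zero>\<^bsub>A\<^esub>, m) \<and>
      e (\<zero>\<^bsub>A\<^esub>, m \<lhd>\<^sub>1\<^bsub>M\<^esub> a) = e (\<zero>\<^bsub>A\<^esub>, m) \<cdot>\<^sub>1\<^bsub>T\<^esub> s a \<and>
      e (\<zero>\<^bsub>A\<^esub>, a \<rhd>\<^sub>2\<^bsub>M\<^esub> m) = s a \<cdot>\<^sub>2\<^bsub>T\<^esub> e (\<zero>\<^bsub>A\<^esub>, m) \<and>
      e (\<zero>\<^bsub>A\<^esub>, m \<lhd>\<^sub>2\<^bsub>M\<^esub> a) = e (\<zero>\<^bsub>A\<^esub>, m) \<cdot>\<^sub>2\<^bsub>T\<^esub> s a"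
    using l[of L1] l[of L2] r[of L1] r[of L2] by simp
qed

text \<open>For the section \<open>a \<mapsto> (a, 0)\<close> the twisted product differs from the product of \<open>A\<close> by exactly the
  cocycle.\<close>

lemma factor_set_twisted: "factor_set K A M twisted (\<lambda>a. e (a, \<zero>\<^bsub>M\<^esub>)) fs"
  unfolding factor_set_def linear_section_def
  using section_hom_T comp_cochain by simp

end

section \<open>Classification by cohomology\<close>

lemma bij_betw_quotient_by_fibres:
  "bij_betw (\<lambda>C. f (SOME x. x \<in> C)) (X // {(x, y). x \<in> X \<and> y \<in> X \<and> f x = f y}) (f ` X)"
proof -
  let ?R = "{(x, y). x \<in> X \<and> y \<in> X \<and> f x = f y}"
  have fibre: "f y = f x" if "y \<in> ?R `` {x}" for x y using that by auto
  have val: "f (SOME y. y \<in> ?R `` {x}) = f x" if "x \<in> X" for x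
  proof -
    have "x \<in> ?R `` {x}" using that by blast
    hence "(SOME y. y \<in> ?R `` {x}) \<in> ?R `` {x}" by (rule someI)
    thus ?thesis by (rule fibre)
  qed
  have "X // ?R = (\<lambda>x. ?R `` {x}) ` X" unfolding quotient_def by blast
  moreover have "inj_on (\<lambda>C. f (SOME x. x \<in> C)) ((\<lambda>x. ?R `` {x}) ` X)"
  proof (rule inj_onI)
    fix C D
    assume C: "C \<in> (\<lambda>x. ?R `` {x}) ` X" and D: "D \<in> (\<lambda>x. ?R `` {x}) ` X"
      and eq: "f (SOME x. x \<in> C) = f (SOME x. x \<in> D)"
    obtain x where x: "C = ?R `` {x}" "x \<in> X" using C by (rule imageE)
    obtain y where y: "D = ?R `` {y}" "y \<in> X" using D by (rule imageE)
    have "f x = f y" using eq unfolding x(1) y(1) val[OF x(2)] val[OF y(2)] .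
    thus "C = D" unfolding x(1) y(1) using x(2) y(2) by simp
  qed
  moreover have "(\<lambda>C. f (SOME x. x \<in> C)) ` (\<lambda>x. ?R `` {x}) ` X = f ` X"
    unfolding image_image using val by (rule image_cong[OF refl])
  ultimately show ?thesis unfolding bij_betw_def by simp
qed

lemma (in algebra_with_bimodule) extension_with_factor_set_exists:
  assumes E: "E \<in> extensions_inducing K A M"
  obtains s fs where "extension_with_factor_set K A M E s fs"
proof -
  interpret inducing_extension K A M E
    using E unfolding extensions_inducing_def by unfold_locales auto
  obtain s where s: "linear_section K A E s" by (rule linear_section_exists)
  interpret split_extension K A M E s by unfold_locales (rule s)
  obtain fs where "factor_set K A M E s fs" by (rule factor_set_exists)
  hence "extension_with_factor_set K A M E s fs" by unfold_locales
  thus ?thesis by (rule that)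
qed

lemma (in algebra_with_bimodule) extension_with_factor_setI:
  assumes E: "E \<in> extensions_inducing K A M" and fs: "factor_set K A M E s fs"
  shows "extension_with_factor_set K A M E s fs"
proof -
  interpret inducing_extension K A M E
    using E unfolding extensions_inducing_def by unfold_locales auto
  show ?thesis by unfold_locales (rule factor_setD(1)[OF fs], rule fs)
qed

context algebra_with_bimodule
begin

definition factor_sets :: "('k, 'a, 'm, 'b) extension \<Rightarrow> ('a list \<Rightarrow> 'm) list set" where
  "factor_sets E = {fs. \<exists>s. factor_set K A M E s fs}"

lemma factor_sets_eq_coset:
  assumes "extension_with_factor_set K A M E s fs"
  shows "factor_sets E =
    comp_coboundaries K A M 2 #>\<^bsub>(comp_cochain_group K A M 2)\<lparr>carrier := comp_cocycles K A M 2\<rparr>\<^esub> fs"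
  unfolding factor_sets_def coset_eq_add_coboundary
    extension_with_factor_set.factor_set_iff_add_coboundary[OF assms] by (simp only: Bex_def conj_commute)

text \<open>The set of factor sets is the coset of any one of its members, so two extensions with a
  common factor set have all factor sets in common.\<close>

lemma equivalent_iff_factor_sets_eq:
  assumes E: "E \<in> extensions_inducing K A M" and E': "E' \<in> extensions_inducing K A M"
  shows "equivalent_extensions K M E E' \<longleftrightarrow> factor_sets E = factor_sets E'"
proof -
  obtain s fs where s: "extension_with_factor_set K A M E s fs"
    by (rule extension_with_factor_set_exists[OF E])
  interpret extension_with_factor_set K A M E s fs by (rule s)
  show ?thesis
  proof
    assume eq: "equivalent_extensions K M E E'"
    have "inducing_extension K A M E'"
      using E' unfolding extensions_inducing_def by unfold_locales auto
    from equivalent_has_same_factor_set[OF this eq] obtain s' where "factor_set K A M E' s' fs" .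
    from extension_with_factor_setI[OF E' this]
    show "factor_sets E = factor_sets E'"
      by (simp only: factor_sets_eq_coset[OF s] factor_sets_eq_coset)
  next
    assume "factor_sets E = factor_sets E'"
    moreover have "fs \<in> factor_sets E"
      unfolding factor_sets_def by (rule CollectI, rule exI[of "\<lambda>s. factor_set K A M E s fs"], rule factor_set)
    ultimately obtain s' where "factor_set K A M E' s' fs"
      unfolding factor_sets_def by auto
    thus "equivalent_extensions K M E E'"
      by (intro equivalent_if_common_factor_set extension_with_factor_setI[OF E'])
  qed
qed

lemma factor_sets_image:
  assumes "inj_on (e :: 'a \<times> 'm \<Rightarrow> 'b) (carrier A \<times> carrier M)"
  shows "factor_sets ` (extensions_inducing K A M :: ('k, 'a, 'm, 'b) extension set) =
    carrier (comp_cohomology K A M 2)"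
proof -
  let ?G = "(comp_cochain_group K A M 2)\<lparr>carrier := comp_cocycles K A M 2\<rparr>"
  have H: "carrier (comp_cohomology K A M 2) =
      (\<lambda>fs. comp_coboundaries K A M 2 #>\<^bsub>?G\<^esub> fs) ` comp_cocycles K A M 2"
    unfolding comp_cohomology_def FactGroup_def RCOSETS_def by auto
  show ?thesis unfolding H
  proof (intro equalityI subsetI; elim imageE)
    fix Z and E :: "('k, 'a, 'm, 'b) extension"
    assume Z: "Z = factor_sets E" and E: "E \<in> extensions_inducing K A M"
    obtain s fs where s: "extension_with_factor_set K A M E s fs"
      by (rule extension_with_factor_set_exists[OF E])
    show "Z \<in> (\<lambda>fs. comp_coboundaries K A M 2 #>\<^bsub>?G\<^esub> fs) ` comp_cocycles K A M 2"
      unfolding Z factor_sets_eq_coset[OF s]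
      by (rule imageI) (rule extension_with_factor_set.factor_set_cocycle[OF s])
  next
    fix Z fs assume Z: "Z = comp_coboundaries K A M 2 #>\<^bsub>?G\<^esub> fs" and fs: "fs \<in> comp_cocycles K A M 2"
    interpret twisted_extension K A M e fs using assms fs by unfold_locales
    have E: "twisted \<in> extensions_inducing K A M"
      unfolding extensions_inducing_def using abelian_extension_twisted induces_bimodule_twisted by simp
    have "Z = factor_sets twisted"
      unfolding Z by (rule factor_sets_eq_coset[OF extension_with_factor_setI[OF E factor_set_twisted], symmetric])
    thus "Z \<in> factor_sets ` (extensions_inducing K A M :: ('k, 'a, 'm, 'b) extension set)" using E by (rule image_eqI)
  qed
qed

end

theorem theorem3p6:
  fixes K :: "('k, 'c) ring_scheme"
    and A :: "('k, 'a) comp_algebra"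
    and M :: "('k, 'a, 'm) comp_bimodule"
  assumes "compatible_algebra K A"
    and "compatible_bimodule K A M"
    and universe: "\<exists>f :: 'a \<times> 'm \<Rightarrow> 'b. inj_on f (carrier A \<times> carrier M)"
  shows "\<exists>\<Phi>. bij_betw \<Phi> (Ext K A M :: ('k, 'a, 'm, 'b) extension set set)
                (carrier (comp_cohomology K A M 2))"
proof -
  interpret algebra_with_bimodule K A M
    using assms(1,2) by (rule algebra_with_bimodule.intro)
  let ?X = "extensions_inducing K A M :: ('k, 'a, 'm, 'b) extension set"
  obtain e :: "'a \<times> 'm \<Rightarrow> 'b" where e: "inj_on e (carrier A \<times> carrier M)" using universe ..
  have "{(E, E'). E \<in> ?X \<and> E' \<in> ?X \<and> equivalent_extensions K M E E'} =
      {(E, E'). E \<in> ?X \<and> E' \<in> ?X \<and> factor_sets E = factor_sets E'}"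
    using equivalent_iff_factor_sets_eq by auto
  hence "Ext K A M = ?X // {(E, E'). E \<in> ?X \<and> E' \<in> ?X \<and> factor_sets E = factor_sets E'}"
    unfolding Ext_def by (rule arg_cong)
  hence "bij_betw (\<lambda>C. factor_sets (SOME E. E \<in> C)) (Ext K A M :: ('k, 'a, 'm, 'b) extension set set)
      (carrier (comp_cohomology K A M 2))"
    using bij_betw_quotient_by_fibres[of factor_sets ?X] by (simp only: factor_sets_image[OF e])
  thus ?thesis by (intro exI)
qed

end
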